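(* Let $I$ be a closed two-sided ideal in a $C^*$-algebra $A$. Then \[ \operatorname{xrr}(A) \leq \max\{ \operatorname{xrr}(I), \operatorname{xrr}(A/I) \}, \] where $\operatorname{xrr}$ denotes the extension real rank.
   Context: For a unital $C^*$-algebra $D$, let $D_{\mathrm{sa}}$ be its set of self-adjoint elements and let $\operatorname{Lg}_n(D)_{\mathrm{sa}}$ be the set of tuples $(a_1,\ldots,a_n)\in (D_{\mathrm{sa}})^n$ such that $\sum_{k=1}^n a_k^2$ is invertible in $D$ (the zero algebra is regarded as unital, with $0=1$ invertible). For a $C^*$-algebra $A$ let $M(A)$ be its multiplier algebra and $\pi_A\colon M(A)\to M(A)/A$ the quotient map. For $n\in\mathbb{N}=\{0,1,2,\ldots\}$, $A$ has property $(\Lambda_n)$ if for every $(a_0,\ldots,a_n)\in M(A)_{\mathrm{sa}}^{n+1}$ with $(\pi_A(a_0),\ldots,\pi_A(a_n))\in\operatorname{Lg}_{n+1}(M(A)/A)_{\mathrm{sa}}$ and every $\varepsilon>0$ there is $(b_0,\ldots,b_n)\in\operatorname{Lg}_{n+1}(M(A))_{\mathrm{sa}}$ with $\|a_j-b_j\|<\varepsilon$ and $\pi_A(a_j)=\pi_A(b_j)$ for $j=0,\ldots,n$. The extension real rank $\operatorname{xrr}(A)$ is the smallest $n\in\mathbb{N}$ such that $A$ has $(\Lambda_m)$ for all $m\geq n$, and $\operatorname{xrr}(A)=\infty$ if no such $n$ exists. *)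

theory Defs
  imports "HOL-Analysis.Analysis" "HOL-Algebra.QuotRing" "HOL-Algebra.Algebraic_Closure_Type"
    "HOL-Library.Extended_Nat"
begin

section \<open>C*-algebras with an explicit carrier\<close>

text \<open>
  The field \<open>one\<close> inherited from the ring record is only meaningful for unital algebras; nothing is
  assumed about it in a general C*-algebra, and its value only matters below for the
  unital algebras \<open>M(A)\<close> and \<open>M(A)/A\<close>.
\<close>

record 'a cstar = "(complex, 'a) module" +
  adj :: "'a \<Rightarrow> 'a"
  nrm :: "'a \<Rightarrow> real"

text \<open>
  \<^const>\<open>Metric_space\<close> requires symmetry and nonnegativity on the whole type, hence the guard.
\<close>

definition cdist :: "'a cstar \<Rightarrow> 'a \<Rightarrow> 'a \<Rightarrow> real" where
  "cdist A x y = (if x \<in> carrier A \<and> y \<in> carrier A then nrm A (x \<ominus>\<^bsub>A\<^esub> y) else 0)"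

locale cstar_algebra = module ring_of_type_algebra A
  for A :: "'a cstar" (structure) +
  assumes mult_closed: "\<lbrakk>x \<in> carrier A; y \<in> carrier A\<rbrakk> \<Longrightarrow> x \<otimes> y \<in> carrier A"
    and mult_assoc: "\<lbrakk>x \<in> carrier A; y \<in> carrier A; z \<in> carrier A\<rbrakk>
      \<Longrightarrow> (x \<otimes> y) \<otimes> z = x \<otimes> (y \<otimes> z)"
    and mult_l_distr: "\<lbrakk>x \<in> carrier A; y \<in> carrier A; z \<in> carrier A\<rbrakk>
      \<Longrightarrow> (x \<oplus> y) \<otimes> z = x \<otimes> z \<oplus> y \<otimes> z"
    and mult_r_distr: "\<lbrakk>x \<in> carrier A; y \<in> carrier A; z \<in> carrier A\<rbrakk>
      \<Longrightarrow> z \<otimes> (x \<oplus> y) = z \<otimes> x \<oplus> z \<otimes> y"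
    and smult_mult_left: "\<lbrakk>x \<in> carrier A; y \<in> carrier A\<rbrakk>
      \<Longrightarrow> (c \<odot> x) \<otimes> y = c \<odot> (x \<otimes> y)"
    and smult_mult_right: "\<lbrakk>x \<in> carrier A; y \<in> carrier A\<rbrakk>
      \<Longrightarrow> x \<otimes> (c \<odot> y) = c \<odot> (x \<otimes> y)"
    and adj_closed: "x \<in> carrier A \<Longrightarrow> adj A x \<in> carrier A"
    and adj_adj: "x \<in> carrier A \<Longrightarrow> adj A (adj A x) = x"
    and adj_add: "\<lbrakk>x \<in> carrier A; y \<in> carrier A\<rbrakk>
      \<Longrightarrow> adj A (x \<oplus> y) = adj A x \<oplus> adj A y"
    and adj_smult: "x \<in> carrier A \<Longrightarrow> adj A (c \<odot> x) = cnj c \<odot> adj A x"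
    and adj_mult: "\<lbrakk>x \<in> carrier A; y \<in> carrier A\<rbrakk>
      \<Longrightarrow> adj A (x \<otimes> y) = adj A y \<otimes> adj A x"
    and nrm_nonneg: "x \<in> carrier A \<Longrightarrow> 0 \<le> nrm A x"
    and nrm_eq_0_iff: "x \<in> carrier A \<Longrightarrow> nrm A x = 0 \<longleftrightarrow> x = \<zero>"
    and nrm_triangle: "\<lbrakk>x \<in> carrier A; y \<in> carrier A\<rbrakk>
      \<Longrightarrow> nrm A (x \<oplus> y) \<le> nrm A x + nrm A y"
    and nrm_smult: "x \<in> carrier A \<Longrightarrow> nrm A (c \<odot> x) = cmod c * nrm A x"
    and nrm_mult: "\<lbrakk>x \<in> carrier A; y \<in> carrier A\<rbrakk>
      \<Longrightarrow> nrm A (x \<otimes> y) \<le> nrm A x * nrm A y"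
    and nrm_adj_mult: "x \<in> carrier A \<Longrightarrow> nrm A (adj A x \<otimes> x) = (nrm A x)\<^sup>2"
    and complete: "Metric_space.mcomplete (carrier A) (cdist A)"

text \<open>
  Closure under the involution is not required: it is a theorem for closed ideals. The ideal
  itself, as an algebra, is \<open>A\<lparr>carrier := I\<rparr>\<close>.
\<close>

definition closed_ideal :: "'a set \<Rightarrow> 'a cstar \<Rightarrow> bool" where
  "closed_ideal I A \<longleftrightarrow>
     additive_subgroup I A \<and>
     (\<forall>c. \<forall>x\<in>I. c \<odot>\<^bsub>A\<^esub> x \<in> I) \<and>
     (\<forall>a\<in>carrier A. \<forall>x\<in>I. a \<otimes>\<^bsub>A\<^esub> x \<in> I \<and> x \<otimes>\<^bsub>A\<^esub> a \<in> I) \<and>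
     closedin (Metric_space.mtopology (carrier A) (cdist A)) I"

text \<open>
  The ring part agrees with \<^const>\<open>FactRing\<close>. The union defining \<open>smult\<close> follows the pattern of
  \<^const>\<open>rcoset_mult\<close>: all members of the family are the same coset.
\<close>

definition cstar_quot :: "'a cstar \<Rightarrow> 'a set \<Rightarrow> 'a set cstar" where
  "cstar_quot A I =
     \<lparr>carrier = a_rcosets\<^bsub>A\<^esub> I, mult = rcoset_mult A I, one = I +>\<^bsub>A\<^esub> \<one>\<^bsub>A\<^esub>,
      zero = I, add = set_add A,
      smult = (\<lambda>c S. \<Union>x\<in>S. I +>\<^bsub>A\<^esub> (c \<odot>\<^bsub>A\<^esub> x)),
      adj = (\<lambda>S. adj A ` S),
      nrm = (\<lambda>S. INF x\<in>S. nrm A x)\<rparr>"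

definition self_adjoint :: "'a cstar \<Rightarrow> 'a set" where
  "self_adjoint D = {x \<in> carrier D. adj D x = x}"


section \<open>The multiplier algebra\<close>

definition bounded_operator :: "'a cstar \<Rightarrow> ('a \<Rightarrow> 'a) \<Rightarrow> bool" where
  "bounded_operator A T \<longleftrightarrow>
     T \<in> carrier A \<rightarrow>\<^sub>E carrier A \<and>
     (\<forall>x\<in>carrier A. \<forall>y\<in>carrier A. T (x \<oplus>\<^bsub>A\<^esub> y) = T x \<oplus>\<^bsub>A\<^esub> T y) \<and>
     (\<forall>c. \<forall>x\<in>carrier A. T (c \<odot>\<^bsub>A\<^esub> x) = c \<odot>\<^bsub>A\<^esub> T x) \<and>
     (\<exists>K. \<forall>x\<in>carrier A. nrm A (T x) \<le> K * nrm A x)"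

text \<open>
  Multipliers are realised as double centralizers \<open>(L, R)\<close>; think of \<open>L x = m x\<close> and \<open>R x = x m\<close>.
\<close>

definition double_centralizers :: "'a cstar \<Rightarrow> (('a \<Rightarrow> 'a) \<times> ('a \<Rightarrow> 'a)) set" where
  "double_centralizers A = {(L, R).
     bounded_operator A L \<and> bounded_operator A R \<and>
     (\<forall>x\<in>carrier A. \<forall>y\<in>carrier A.
        L (x \<otimes>\<^bsub>A\<^esub> y) = L x \<otimes>\<^bsub>A\<^esub> y \<and>
        R (x \<otimes>\<^bsub>A\<^esub> y) = x \<otimes>\<^bsub>A\<^esub> R y \<and>
        R x \<otimes>\<^bsub>A\<^esub> y = x \<otimes>\<^bsub>A\<^esub> L y)}"

definition multiplier_algebra :: "'a cstar \<Rightarrow> (('a \<Rightarrow> 'a) \<times> ('a \<Rightarrow> 'a)) cstar" where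
  "multiplier_algebra A =
     \<lparr>carrier = double_centralizers A,
      mult = (\<lambda>(L1, R1) (L2, R2). (compose (carrier A) L1 L2, compose (carrier A) R2 R1)),
      one = (\<lambda>x\<in>carrier A. x, \<lambda>x\<in>carrier A. x),
      zero = (\<lambda>x\<in>carrier A. \<zero>\<^bsub>A\<^esub>, \<lambda>x\<in>carrier A. \<zero>\<^bsub>A\<^esub>),
      add = (\<lambda>(L1, R1) (L2, R2).
        (\<lambda>x\<in>carrier A. L1 x \<oplus>\<^bsub>A\<^esub> L2 x, \<lambda>x\<in>carrier A. R1 x \<oplus>\<^bsub>A\<^esub> R2 x)),
      smult = (\<lambda>c (L, R). (\<lambda>x\<in>carrier A. c \<odot>\<^bsub>A\<^esub> L x, \<lambda>x\<in>carrier A. c \<odot>\<^bsub>A\<^esub> R x)),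
      adj = (\<lambda>(L, R).
        (\<lambda>x\<in>carrier A. adj A (R (adj A x)), \<lambda>x\<in>carrier A. adj A (L (adj A x)))),
      nrm = (\<lambda>(L, R). SUP x\<in>{x \<in> carrier A. nrm A x \<le> 1}. nrm A (L x))\<rparr>"

definition multiplier_embedding :: "'a cstar \<Rightarrow> 'a \<Rightarrow> ('a \<Rightarrow> 'a) \<times> ('a \<Rightarrow> 'a)" where
  "multiplier_embedding A a = (\<lambda>x\<in>carrier A. a \<otimes>\<^bsub>A\<^esub> x, \<lambda>x\<in>carrier A. x \<otimes>\<^bsub>A\<^esub> a)"

definition canonical_ideal :: "'a cstar \<Rightarrow> (('a \<Rightarrow> 'a) \<times> ('a \<Rightarrow> 'a)) set" where
  "canonical_ideal A = multiplier_embedding A ` carrier A"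

definition corona_algebra :: "'a cstar \<Rightarrow> (('a \<Rightarrow> 'a) \<times> ('a \<Rightarrow> 'a)) set cstar" where
  "corona_algebra A = cstar_quot (multiplier_algebra A) (canonical_ideal A)"

definition corona_map ::
    "'a cstar \<Rightarrow> ('a \<Rightarrow> 'a) \<times> ('a \<Rightarrow> 'a) \<Rightarrow> (('a \<Rightarrow> 'a) \<times> ('a \<Rightarrow> 'a)) set" where
  "corona_map A m = canonical_ideal A +>\<^bsub>multiplier_algebra A\<^esub> m"


section \<open>The extension real rank\<close>

text \<open>
  An \<open>n\<close>-tuple is a function on \<open>nat\<close> of which only the values at \<open>0, \<dots>, n - 1\<close> matter.
\<close>

definition Lg_sa :: "nat \<Rightarrow> 'a cstar \<Rightarrow> (nat \<Rightarrow> 'a) set" where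
  "Lg_sa n D = {a \<in> {..<n} \<rightarrow> self_adjoint D. (\<Oplus>\<^bsub>D\<^esub>k\<in>{..<n}. a k \<otimes>\<^bsub>D\<^esub> a k) \<in> Units D}"

definition property_Lambda :: "nat \<Rightarrow> 'a cstar \<Rightarrow> bool" where
  "property_Lambda n A \<longleftrightarrow>
     (\<forall>a \<in> {..<n + 1} \<rightarrow> self_adjoint (multiplier_algebra A).
        (\<lambda>j. corona_map A (a j)) \<in> Lg_sa (n + 1) (corona_algebra A) \<longrightarrow>
        (\<forall>\<epsilon>>0. \<exists>b \<in> Lg_sa (n + 1) (multiplier_algebra A). \<forall>j\<le>n.
           nrm (multiplier_algebra A) (a j \<ominus>\<^bsub>multiplier_algebra A\<^esub> b j) < \<epsilon> \<and>
           corona_map A (a j) = corona_map A (b j)))"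

definition xrr :: "'a cstar \<Rightarrow> enat" where
  "xrr A =
     (if \<exists>n. \<forall>m\<ge>n. property_Lambda m A
      then enat (LEAST n. \<forall>m\<ge>n. property_Lambda m A)
      else \<infinity>)"

end

theory Submission
  imports Defs
begin

text \<open>
  If \<open>I\<close> and \<open>A/I\<close> have \<open>(\<Lambda>\<^sub>n)\<close>, so does \<open>A\<close>. Let \<open>a\<close> be a self-adjoint tuple in \<open>M(A)\<close> such that
  \<open>\<Sum> a\<^sub>k\<^sup>2\<close> is invertible modulo \<open>A\<close>, and map it to \<open>M(A/I)\<close>. By \<open>(\<Lambda>\<^sub>n)\<close> for \<open>A/I\<close> a small perturbation
  of the image by elements of \<open>A/I\<close> is unimodular; lift the perturbation to \<open>A\<close>. An element
  of \<open>M(A)\<close> that is invertible modulo \<open>A\<close> and has an invertible image in \<open>M(A/I)\<close> is invertible modulo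
  the part \<open>I\<close> of \<open>A\<close> that dies in \<open>M(A/I)\<close>. Now repeat the argument with the restriction
  \<open>M(A) \<rightarrow> M(I)\<close> and \<open>(\<Lambda>\<^sub>n)\<close> for \<open>I\<close>: the perturbed sum of squares becomes invertible modulo the part of \<open>I\<close>
  that dies in \<open>M(I)\<close>, which is \<open>0\<close>. Approximate units of closed ideals provide the two
  homomorphisms and the isometry of the embeddings \<open>I \<rightarrow> M(I)\<close> and \<open>A/I \<rightarrow> M(A/I)\<close>.
\<close>

section \<open>Normed algebras with involution\<close>

text \<open>Seen inside \<open>M(A)\<close>, the argument lowers a modulus along the chain
  \<open>A\<close>, \<open>I\<close>, \<open>0\<close>: invertibility modulo one ideal becomes
  invertibility modulo the next, at the price of a perturbation of size \<epsilon>/2 taken from the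
  larger one. Both stages are instances of \<open>property_Lambda_lift\<close>, which concerns a
  homomorphism from an ideal \<open>Y\<close> onto \<open>B\<close> and lowers the modulus from
  \<open>Y\<close> to the kernel. A perturbation found in \<open>B\<close> is lifted to
  \<open>Y\<close>, and not to arbitrary multipliers, because only then does invertibility modulo
  \<open>Y\<close> survive it. Completeness and the C*-identity enter through the isometry of the
  involution and the approximate units of closed ideals of \<open>A\<close>. Approximate units pass
  to \<open>I\<close> and \<open>A/I\<close>, and from there on the three algebras are treated alike
  as normed algebras with isometric involution. Since \<open>A\<close> need not have a unit,
  \<open>h + \<i>d\<close> cannot be inverted in \<open>A\<close> itself; its resolvent appears only
  through the equation \<open>h e + \<i>d e = h\<close>, solved inside the ideal.\<close>

lemma carrier_ring_of_type_algebra [simp]: "carrier ring_of_type_algebra = UNIV"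
  and add_ring_of_type_algebra [simp]: "add ring_of_type_algebra = (+)"
  and mult_ring_of_type_algebra [simp]: "monoid.mult ring_of_type_algebra = (*)"
  and one_ring_of_type_algebra [simp]: "one ring_of_type_algebra = 1"
  and zero_ring_of_type_algebra [simp]: "zero ring_of_type_algebra = 0"
  by (simp_all add: ring_of_type_algebra_def)

text \<open>The common ground of \<open>A\<close>, \<open>I\<close> and \<open>A/I\<close>: each is
  an instance by elementary arguments, with the isometry of the involution standing for what the
  C*-identity says about it.\<close>

locale star_algebra = module ring_of_type_algebra A
  for A :: "'a cstar" (structure) +
  assumes mult_closed [simp]: "\<lbrakk>x \<in> carrier A; y \<in> carrier A\<rbrakk> \<Longrightarrow> x \<otimes> y \<in> carrier A"
    and mult_assoc: "\<lbrakk>x \<in> carrier A; y \<in> carrier A; z \<in> carrier A\<rbrakk>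
      \<Longrightarrow> (x \<otimes> y) \<otimes> z = x \<otimes> (y \<otimes> z)"
    and mult_l_distr: "\<lbrakk>x \<in> carrier A; y \<in> carrier A; z \<in> carrier A\<rbrakk>
      \<Longrightarrow> (x \<oplus> y) \<otimes> z = x \<otimes> z \<oplus> y \<otimes> z"
    and mult_r_distr: "\<lbrakk>x \<in> carrier A; y \<in> carrier A; z \<in> carrier A\<rbrakk>
      \<Longrightarrow> z \<otimes> (x \<oplus> y) = z \<otimes> x \<oplus> z \<otimes> y"
    and smult_mult_left: "\<lbrakk>x \<in> carrier A; y \<in> carrier A\<rbrakk>
      \<Longrightarrow> (c \<odot> x) \<otimes> y = c \<odot> (x \<otimes> y)"
    and smult_mult_right: "\<lbrakk>x \<in> carrier A; y \<in> carrier A\<rbrakk>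
      \<Longrightarrow> x \<otimes> (c \<odot> y) = c \<odot> (x \<otimes> y)"
    and adj_closed [simp]: "x \<in> carrier A \<Longrightarrow> adj A x \<in> carrier A"
    and adj_adj [simp]: "x \<in> carrier A \<Longrightarrow> adj A (adj A x) = x"
    and adj_add: "\<lbrakk>x \<in> carrier A; y \<in> carrier A\<rbrakk>
      \<Longrightarrow> adj A (x \<oplus> y) = adj A x \<oplus> adj A y"
    and adj_smult: "x \<in> carrier A \<Longrightarrow> adj A (c \<odot> x) = cnj c \<odot> adj A x"
    and adj_mult: "\<lbrakk>x \<in> carrier A; y \<in> carrier A\<rbrakk>
      \<Longrightarrow> adj A (x \<otimes> y) = adj A y \<otimes> adj A x"
    and nrm_nonneg [simp]: "x \<in> carrier A \<Longrightarrow> 0 \<le> nrm A x"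
    and nrm_eq_0_iff: "x \<in> carrier A \<Longrightarrow> nrm A x = 0 \<longleftrightarrow> x = \<zero>"
    and nrm_triangle: "\<lbrakk>x \<in> carrier A; y \<in> carrier A\<rbrakk>
      \<Longrightarrow> nrm A (x \<oplus> y) \<le> nrm A x + nrm A y"
    and nrm_smult: "x \<in> carrier A \<Longrightarrow> nrm A (c \<odot> x) = cmod c * nrm A x"
    and nrm_mult: "\<lbrakk>x \<in> carrier A; y \<in> carrier A\<rbrakk>
      \<Longrightarrow> nrm A (x \<otimes> y) \<le> nrm A x * nrm A y"
    and nrm_adj: "x \<in> carrier A \<Longrightarrow> nrm A (adj A x) = nrm A x"
begin

lemma smult_closed' [simp]: "x \<in> carrier A \<Longrightarrow> c \<odot> x \<in> carrier A"
  by simp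

lemma smult_add_left: "x \<in> carrier A \<Longrightarrow> (c + d) \<odot> x = c \<odot> x \<oplus> d \<odot> x"
  using smult_l_distr[of c d x] by simp

lemma smult_add_right: "\<lbrakk>x \<in> carrier A; y \<in> carrier A\<rbrakk> \<Longrightarrow> c \<odot> (x \<oplus> y) = c \<odot> x \<oplus> c \<odot> y"
  using smult_r_distr[of c x y] by simp

lemma smult_smult: "x \<in> carrier A \<Longrightarrow> c \<odot> (d \<odot> x) = (c * d) \<odot> x"
  using smult_assoc1[of c d x] by simp

lemma smult_1 [simp]: "x \<in> carrier A \<Longrightarrow> 1 \<odot> x = x"
  using smult_one[of x] by simp

lemma smult_0 [simp]: "x \<in> carrier A \<Longrightarrow> 0 \<odot> x = \<zero>"
  using smult_add_left[of x 0 0] M.add.l_cancel_one[of "0 \<odot> x" "0 \<odot> x"] by simp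

lemma smult_zero [simp]: "c \<odot> \<zero> = \<zero>"
  using smult_smult[of \<zero> c 0] by simp

lemma smult_minus_1: "x \<in> carrier A \<Longrightarrow> (-1) \<odot> x = \<ominus> x"
  using smult_add_left[of x "-1" 1] M.minus_equality[of "(-1) \<odot> x" x] by simp

text \<open>There need not be a unit, so the laws for \<zero> and \<ominus> are drawn from the
  scalars \<open>0\<close> and \<open>-1\<close> instead of from ring laws.\<close>

lemma l_null [simp]: "x \<in> carrier A \<Longrightarrow> \<zero> \<otimes> x = \<zero>"
  using smult_mult_left[of \<zero> x 0] by simp

lemma r_null [simp]: "x \<in> carrier A \<Longrightarrow> x \<otimes> \<zero> = \<zero>"
  using smult_mult_right[of x \<zero> 0] by simp

lemma l_minus: "\<lbrakk>x \<in> carrier A; y \<in> carrier A\<rbrakk> \<Longrightarrow> (\<ominus> x) \<otimes> y = \<ominus> (x \<otimes> y)"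
  using smult_mult_left[of x y "-1"] by (simp add: smult_minus_1)

lemma r_minus: "\<lbrakk>x \<in> carrier A; y \<in> carrier A\<rbrakk> \<Longrightarrow> x \<otimes> (\<ominus> y) = \<ominus> (x \<otimes> y)"
  using smult_mult_right[of x y "-1"] by (simp add: smult_minus_1)

lemma mult_minus_right:
  "\<lbrakk>x \<in> carrier A; y \<in> carrier A; z \<in> carrier A\<rbrakk> \<Longrightarrow> x \<otimes> (y \<ominus> z) = x \<otimes> y \<ominus> x \<otimes> z"
  by (simp add: M.minus_eq mult_r_distr r_minus)

lemma mult_minus_left:
  "\<lbrakk>x \<in> carrier A; y \<in> carrier A; z \<in> carrier A\<rbrakk> \<Longrightarrow> (x \<ominus> y) \<otimes> z = x \<otimes> z \<ominus> y \<otimes> z"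
  by (simp add: M.minus_eq mult_l_distr l_minus)

lemma adj_uminus: "x \<in> carrier A \<Longrightarrow> adj A (\<ominus> x) = \<ominus> adj A x"
  using adj_smult[of x "-1"] by (simp add: smult_minus_1)

lemma adj_minus: "\<lbrakk>x \<in> carrier A; y \<in> carrier A\<rbrakk> \<Longrightarrow> adj A (x \<ominus> y) = adj A x \<ominus> adj A y"
  by (simp add: M.minus_eq adj_add adj_uminus)

lemma nrm_zero [simp]: "nrm A \<zero> = 0"
  by (simp add: nrm_eq_0_iff)

lemma nrm_uminus: "x \<in> carrier A \<Longrightarrow> nrm A (\<ominus> x) = nrm A x"
  using nrm_smult[of x "-1"] by (simp add: smult_minus_1)

lemma nrm_minus_le: "\<lbrakk>x \<in> carrier A; y \<in> carrier A\<rbrakk> \<Longrightarrow> nrm A (x \<ominus> y) \<le> nrm A x + nrm A y"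
  using nrm_triangle[of x "\<ominus> y"] by (simp add: M.minus_eq nrm_uminus)

lemma minus_swap: "\<lbrakk>x \<in> carrier A; y \<in> carrier A\<rbrakk> \<Longrightarrow> \<ominus> (x \<ominus> y) = y \<ominus> x"
  by (simp add: M.minus_eq M.minus_add M.a_comm)

lemma nrm_minus_commute: "\<lbrakk>x \<in> carrier A; y \<in> carrier A\<rbrakk> \<Longrightarrow> nrm A (x \<ominus> y) = nrm A (y \<ominus> x)"
  using nrm_uminus[of "x \<ominus> y"] by (simp add: minus_swap)

lemma minus_add_cancel: "\<lbrakk>x \<in> carrier A; y \<in> carrier A\<rbrakk> \<Longrightarrow> (x \<ominus> y) \<oplus> y = x"
  by (simp add: M.minus_eq M.a_assoc M.l_neg)

lemma add_minus_cancel: "\<lbrakk>x \<in> carrier A; y \<in> carrier A\<rbrakk> \<Longrightarrow> (x \<oplus> y) \<ominus> y = x"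
  by (simp add: M.minus_eq M.a_assoc M.r_neg)

lemma minus_eq_zero_iff [simp]:
  "\<lbrakk>x \<in> carrier A; y \<in> carrier A\<rbrakk> \<Longrightarrow> x \<ominus> y = \<zero> \<longleftrightarrow> x = y"
  using minus_add_cancel[of x y] by (auto simp: M.minus_eq M.r_neg)

lemma minus_minus_cancel: "\<lbrakk>x \<in> carrier A; y \<in> carrier A\<rbrakk> \<Longrightarrow> x \<ominus> (x \<ominus> y) = y"
proof -
  assume xy: "x \<in> carrier A" "y \<in> carrier A"
  then have "x \<ominus> (x \<ominus> y) = x \<oplus> (y \<oplus> \<ominus> x)"
    using minus_swap by (simp add: M.minus_eq)
  also have "\<dots> = x \<oplus> (\<ominus> x \<oplus> y)"
    using xy by (simp add: M.a_comm)
  also have "\<dots> = y"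
    using xy by (simp add: M.a_assoc [symmetric] M.r_neg)
  finally show ?thesis .
qed

lemma minus_trans:
  assumes "x \<in> carrier A" "y \<in> carrier A" "z \<in> carrier A"
  shows "x \<ominus> z = (x \<ominus> y) \<oplus> (y \<ominus> z)"
proof -
  have "(x \<ominus> y) \<oplus> (y \<ominus> z) = ((x \<ominus> y) \<oplus> y) \<oplus> \<ominus> z"
    using assms by (simp add: M.minus_eq M.a_assoc)
  then show ?thesis
    using assms by (simp add: minus_add_cancel) (simp add: M.minus_eq)
qed

lemma minus_minus_minus:
  assumes "x \<in> carrier A" "y \<in> carrier A" "z \<in> carrier A"
  shows "(x \<ominus> y) \<ominus> (x \<ominus> z) = z \<ominus> y"
proof -
  have "(x \<ominus> y) \<ominus> (x \<ominus> z) = (x \<ominus> y) \<oplus> (z \<ominus> x)"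
    using assms minus_swap by (simp add: M.minus_eq)
  also have "\<dots> = (z \<ominus> x) \<oplus> (x \<ominus> y)"
    using assms by (simp add: M.a_comm)
  finally show ?thesis
    using assms by (simp add: minus_trans[of z x y])
qed

lemma smult_minus: "\<lbrakk>x \<in> carrier A; y \<in> carrier A\<rbrakk> \<Longrightarrow> c \<odot> (x \<ominus> y) = c \<odot> x \<ominus> c \<odot> y"
  by (simp add: M.minus_eq smult_minus_1[symmetric] smult_add_right smult_smult mult.commute)

lemma nrm_minus_triangle:
  assumes "x \<in> carrier A" "y \<in> carrier A" "z \<in> carrier A"
  shows "nrm A (x \<ominus> z) \<le> nrm A (x \<ominus> y) + nrm A (y \<ominus> z)"
  using assms nrm_triangle[of "x \<ominus> y" "y \<ominus> z"] by (simp add: minus_trans[of x y z])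

lemma Metric_space_cdist: "Metric_space (carrier A) (cdist A)"
proof
  fix x y z
  show "0 \<le> cdist A x y"
    by (simp add: cdist_def)
  show "cdist A x y = cdist A y x"
    by (simp add: cdist_def nrm_minus_commute)
  show "cdist A x y = 0 \<longleftrightarrow> x = y" if "x \<in> carrier A" "y \<in> carrier A"
    using that by (simp add: cdist_def nrm_eq_0_iff minus_eq_zero_iff)
  show "cdist A x z \<le> cdist A x y + cdist A y z"
    if "x \<in> carrier A" "y \<in> carrier A" "z \<in> carrier A"
    using that nrm_minus_triangle by (simp add: cdist_def)
qed

end

lemma (in cstar_algebra) nrm_adj_le: "x \<in> carrier A \<Longrightarrow> nrm A x \<le> nrm A (adj A x)"
proof (cases "nrm A x = 0")
  case False
  assume x: "x \<in> carrier A"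
  have "(nrm A x)\<^sup>2 \<le> nrm A (adj A x) * nrm A x"
    using nrm_adj_mult[of x] nrm_mult[of "adj A x" x] x adj_closed by simp
  then show ?thesis
    using False nrm_nonneg[OF x] by (simp add: power2_eq_square)
qed (simp add: nrm_nonneg adj_closed)

lemma (in cstar_algebra) star_algebra: "star_algebra A"
proof -
  have "nrm A (adj A x) = nrm A x" if "x \<in> carrier A" for x
    using nrm_adj_le[of x] nrm_adj_le[of "adj A x"] that by (simp add: adj_adj adj_closed)
  then show ?thesis
    by unfold_locales (rule mult_closed mult_assoc mult_l_distr mult_r_distr smult_mult_left
      smult_mult_right adj_closed adj_adj adj_add adj_smult adj_mult nrm_nonneg nrm_eq_0_iff
      nrm_triangle nrm_smult nrm_mult; assumption | assumption)+
qed


section \<open>Closed ideals and approximate units\<close>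

lemma (in Metric_space) geometric_MCauchy:
  assumes x: "\<And>n. x n \<in> M" and q: "0 \<le> q" "q < 1"
    and step: "\<And>n. d (x n) (x (Suc n)) \<le> D * q ^ n"
  shows "MCauchy x"
proof -
  have dist: "d (x m) (x (m + k)) \<le> (\<Sum>i<k. D * q ^ (m + i))" for m k
  proof (induction k)
    case (Suc k)
    have "d (x m) (x (m + Suc k)) \<le> d (x m) (x (m + k)) + d (x (m + k)) (x (Suc (m + k)))"
      using triangle x by simp
    also have "\<dots> \<le> (\<Sum>i<k. D * q ^ (m + i)) + D * q ^ (m + k)"
      using Suc.IH step[of "m + k"] by linarith
    finally show ?case by simp
  qed (use x in simp)
  have D: "0 \<le> D"
    using order_trans[OF nonneg step[of 0]] by simp
  have bound: "d (x m) (x n) \<le> D * q ^ m / (1 - q)" if "m \<le> n" for m n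
  proof -
    obtain k where k: "n = m + k"
      using \<open>m \<le> n\<close> le_Suc_ex by blast
    have "(\<Sum>i<k. D * q ^ (m + i)) = D * q ^ m * (\<Sum>i<k. q ^ i)"
      by (simp add: power_add sum_distrib_left mult.assoc)
    also have "(\<Sum>i<k. q ^ i) = (1 - q ^ k) / (1 - q)"
      using q by (simp add: sum_gp_strict)
    also have "D * q ^ m * ((1 - q ^ k) / (1 - q)) \<le> D * q ^ m * (1 / (1 - q))"
      using q D by (intro mult_left_mono divide_right_mono) auto
    finally show ?thesis
      using dist[of m k] k by simp
  qed
  have lim: "(\<lambda>n. D * q ^ n / (1 - q)) \<longlonglongrightarrow> 0"
    using tendsto_mult_right_zero[OF LIMSEQ_power_zero[of q], of "D / (1 - q)"] q
    by (simp add: field_simps)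
  show ?thesis
    unfolding MCauchy_def
  proof (intro conjI strip)
    fix \<epsilon> :: real assume "0 < \<epsilon>"
    then have "\<forall>\<^sub>F n in sequentially. D * q ^ n / (1 - q) < \<epsilon>"
      using lim by (rule order_tendstoD(2)[rotated])
    then obtain N where N: "\<And>n. N \<le> n \<Longrightarrow> D * q ^ n / (1 - q) < \<epsilon>"
      by (auto simp: eventually_sequentially)
    have "d (x n) (x n') < \<epsilon>" if "N \<le> n" "N \<le> n'" for n n'
      using that
      by (metis N bound commute le_cases order_le_less_trans)
    then show "\<exists>N. \<forall>n n'. N \<le> n \<longrightarrow> N \<le> n' \<longrightarrow> d (x n) (x n') < \<epsilon>"
      by blast
  qed (use x in auto)
qed

text \<open>The contraction principle is needed on a closed subset, so that the resolvent found as a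
  fixpoint lies in the ideal and not just in \<open>A\<close>.\<close>

lemma (in Metric_space) Banach_fixpoint_closedin:
  assumes mcomplete and C: "closedin mtopology C" "C \<noteq> {}"
    and f: "f ` C \<subseteq> C" and q: "0 \<le> q" "q < 1"
    and contr: "\<And>x y. \<lbrakk>x \<in> C; y \<in> C\<rbrakk> \<Longrightarrow> d (f x) (f y) \<le> q * d x y"
  shows "\<exists>x\<in>C. f x = x"
proof -
  have CM: "C \<subseteq> M"
    using C closedin_metric by blast
  obtain x0 where x0: "x0 \<in> C"
    using C by blast
  define x where "x = (\<lambda>n. (f ^^ n) x0)"
  have xC: "x n \<in> C" for n
    unfolding x_def using f x0 by (induction n) auto
  have "d (x n) (x (Suc n)) \<le> d (x 0) (x 1) * q ^ n" for n
  proof (induction n)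
    case (Suc n)
    have "d (x (Suc n)) (x (Suc (Suc n))) \<le> q * d (x n) (x (Suc n))"
      using contr[OF xC[of n] xC[of "Suc n"]] by (simp add: x_def)
    also have "\<dots> \<le> q * (d (x 0) (x 1) * q ^ n)"
      using Suc q by (intro mult_left_mono) auto
    finally show ?case by (simp add: mult_ac)
  qed simp
  then have "MCauchy x"
    using geometric_MCauchy[of x q] xC CM q by blast
  then obtain l where l: "limitin mtopology x l sequentially"
    using \<open>mcomplete\<close> unfolding mcomplete_def by blast
  have lC: "l \<in> C"
    using metric_closedin_iff_sequentially_closed C(1) l xC by blast
  then have lM: "l \<in> M" "f l \<in> M"
    using CM f by auto
  have "d (f l) l \<le> \<epsilon>" if "0 < \<epsilon>" for \<epsilon>
  proof -
    have "\<exists>N. \<forall>n\<ge>N. x n \<in> M \<and> d (x n) l < \<epsilon> / 2"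
      using l \<open>0 < \<epsilon>\<close> unfolding limit_metric_sequentially by (meson half_gt_zero)
    then obtain N where N: "\<And>n. N \<le> n \<Longrightarrow> d (x n) l < \<epsilon> / 2"
      by blast
    have "d (f l) (x (Suc N)) \<le> q * d l (x N)"
      using contr[OF lC xC[of N]] by (simp add: x_def)
    also have "\<dots> \<le> d l (x N)"
      using q mult_right_mono[of q 1 "d l (x N)"] nonneg by simp
    finally have "d (f l) (x (Suc N)) \<le> \<epsilon> / 2"
      using N[of N] commute[of l "x N"] by simp
    moreover have "d (f l) l \<le> d (f l) (x (Suc N)) + d (x (Suc N)) l"
      using triangle lM xC CM by blast
    ultimately show ?thesis
      using N[of "Suc N"] by simp
  qed
  then have "d (f l) l = 0"
    using nonneg[of "f l" l] by (metis field_le_epsilon add_0 order_antisym)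
  then show ?thesis
    using lC lM by auto
qed

text \<open>A point outside \<open>I\<close> has a ball around it that misses \<open>I\<close>.
  Later memberships in \<open>I\<close> are proved by approximation in this way.\<close>

lemma (in star_algebra) closed_ideal_approx:
  assumes "closed_ideal I A" and x: "x \<in> carrier A"
    and approx: "\<And>\<delta>. 0 < \<delta> \<Longrightarrow> \<exists>i\<in>I. nrm A (x \<ominus> i) < \<delta>"
  shows "x \<in> I"
proof (rule ccontr)
  interpret MS: Metric_space "carrier A" "cdist A"
    by (rule Metric_space_cdist)
  have cl: "closedin MS.mtopology I"
    using assms(1) by (simp add: closed_ideal_def)
  then have sub: "I \<subseteq> carrier A"
    using MS.closedin_metric by blast
  assume "x \<notin> I"
  then obtain r where r: "0 < r" "disjnt I (MS.mball x r)"
    using cl x MS.closedin_metric by blast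
  obtain i where "i \<in> I" "nrm A (x \<ominus> i) < r"
    using approx[OF r(1)] by blast
  then have "i \<in> MS.mball x r"
    using sub x by (auto simp: cdist_def)
  then show False
    using r(2) \<open>i \<in> I\<close> by (auto simp: disjnt_def)
qed

lemma closed_idealD:
  assumes "closed_ideal I A"
  shows closed_ideal_subgroup: "additive_subgroup I A"
    and closed_ideal_smult: "x \<in> I \<Longrightarrow> c \<odot>\<^bsub>A\<^esub> x \<in> I"
    and closed_ideal_mult_left: "\<lbrakk>a \<in> carrier A; x \<in> I\<rbrakk> \<Longrightarrow> a \<otimes>\<^bsub>A\<^esub> x \<in> I"
    and closed_ideal_mult_right: "\<lbrakk>a \<in> carrier A; x \<in> I\<rbrakk> \<Longrightarrow> x \<otimes>\<^bsub>A\<^esub> a \<in> I"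
    and closed_ideal_closedin: "closedin (Metric_space.mtopology (carrier A) (cdist A)) I"
  using assms by (auto simp: closed_ideal_def)

lemma (in star_algebra) closed_ideal_subset: "closed_ideal I A \<Longrightarrow> I \<subseteq> carrier A"
  using closed_ideal_subgroup additive_subgroup.a_subset by blast

lemma (in star_algebra) closed_ideal_minus:
  "\<lbrakk>closed_ideal I A; x \<in> I; y \<in> I\<rbrakk> \<Longrightarrow> x \<ominus> y \<in> I"
  using closed_ideal_subgroup[of I A] closed_ideal_smult[of I A y "-1"] closed_ideal_subset[of I]
  by (auto simp: M.minus_eq smult_minus_1 additive_subgroup.a_closed)

text \<open>
  In the unitization this is \<open>\<parallel>h - \<i>L\<parallel>\<^sup>2 \<le> \<parallel>h\<parallel>\<^sup>2 + L\<^sup>2\<close>. Together with completeness it makes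
  \<open>h + \<i>d\<close> invertible for small \<open>d > 0\<close> without any spectral theory: shift by \<open>\<i>L\<close> with \<open>L\<close>
  large and solve the resulting fixpoint equation.
\<close>

lemma (in cstar_algebra) nrm_shift_le:
  assumes h: "h \<in> carrier A" "adj A h = h" and x: "x \<in> carrier A" and L: "0 \<le> L"
  shows "nrm A (h \<otimes> x \<ominus> (\<i> * complex_of_real L) \<odot> x)
    \<le> sqrt ((nrm A h)\<^sup>2 + L\<^sup>2) * nrm A x"
proof -
  interpret S: star_algebra A by (rule star_algebra)
  define c where "c = \<i> * complex_of_real L"
  define y where "y = h \<otimes> x"
  have y: "y \<in> carrier A" using h x by (simp add: y_def)
  \<comment> \<open>Self-adjointness of \<open>h\<close> is what makes the two mixed terms
    \<open>c \<odot> (adj A x \<otimes> y)\<close> cancel in the product below.\<close>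
  have xy: "adj A y \<otimes> x = adj A x \<otimes> y"
    using h x by (simp add: y_def S.adj_mult S.mult_assoc)
  have c: "cnj c = - c"
    by (simp add: c_def)
  have adjy: "adj A (y \<ominus> c \<odot> x) = adj A y \<oplus> c \<odot> adj A x"
  proof -
    have "y \<ominus> c \<odot> x = y \<oplus> (- c) \<odot> x"
      using x S.smult_smult[of x "-1" c] by (simp add: M.minus_eq S.smult_minus_1)
    then show ?thesis
      using x y c by (simp add: S.adj_add S.adj_smult)
  qed
  have "adj A (y \<ominus> c \<odot> x) \<otimes> (y \<ominus> c \<odot> x)
      = adj A y \<otimes> (y \<ominus> c \<odot> x) \<oplus> (c \<odot> adj A x) \<otimes> (y \<ominus> c \<odot> x)"
    using x y by (simp add: adjy S.mult_l_distr)
  also have "\<dots> = (adj A y \<otimes> y \<ominus> c \<odot> (adj A x \<otimes> y))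
      \<oplus> (c \<odot> (adj A x \<otimes> y) \<ominus> c \<odot> (c \<odot> (adj A x \<otimes> x)))"
    using x y by (simp add: S.mult_minus_right S.smult_mult_left S.smult_mult_right xy)
  also have "\<dots> = adj A y \<otimes> y \<ominus> c \<odot> (c \<odot> (adj A x \<otimes> x))"
    using x y by (simp add: S.minus_trans[symmetric])
  finally have eq: "adj A (y \<ominus> c \<odot> x) \<otimes> (y \<ominus> c \<odot> x)
      = adj A y \<otimes> y \<ominus> (c * c) \<odot> (adj A x \<otimes> x)"
    using x y by (simp add: S.smult_smult)
  have "(nrm A (y \<ominus> c \<odot> x))\<^sup>2 = nrm A (adj A (y \<ominus> c \<odot> x) \<otimes> (y \<ominus> c \<odot> x))"
    using x y by (simp add: nrm_adj_mult)
  also have "\<dots> \<le> nrm A (adj A y \<otimes> y) + nrm A ((c * c) \<odot> (adj A x \<otimes> x))"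
    unfolding eq using x y by (intro S.nrm_minus_le) auto
  also have "\<dots> = (nrm A y)\<^sup>2 + L\<^sup>2 * (nrm A x)\<^sup>2"
    using x y L by (simp add: nrm_adj_mult S.nrm_smult c_def norm_mult power2_eq_square)
  also have "(nrm A y)\<^sup>2 \<le> (nrm A h * nrm A x)\<^sup>2"
    unfolding y_def using h x by (intro power_mono S.nrm_mult S.nrm_nonneg) auto
  finally have "(nrm A (y \<ominus> c \<odot> x))\<^sup>2 \<le> ((nrm A h)\<^sup>2 + L\<^sup>2) * (nrm A x)\<^sup>2"
    by (simp add: algebra_simps power_mult_distrib)
  then have "nrm A (y \<ominus> c \<odot> x) \<le> sqrt (((nrm A h)\<^sup>2 + L\<^sup>2) * (nrm A x)\<^sup>2)"
    using real_le_rsqrt by blast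
  then show ?thesis
    using x by (simp add: y_def c_def real_sqrt_mult)
qed

lemma (in cstar_algebra) ex_resolvent:
  assumes I: "closed_ideal I A" and h: "h \<in> I" "adj A h = h" and d: "0 < d"
  shows "\<exists>e\<in>I. h \<otimes> e \<oplus> (\<i> * complex_of_real d) \<odot> e = h"
proof -
  interpret S: star_algebra A by (rule star_algebra)
  interpret MS: Metric_space "carrier A" "cdist A"
    by (rule S.Metric_space_cdist)
  have sub: "\<And>x. x \<in> I \<Longrightarrow> x \<in> carrier A" and hA: "h \<in> carrier A"
    using S.closed_ideal_subset[OF I] h by auto
  \<comment> \<open>Adding \<open>\<i>L e\<close> to both sides of \<open>\<i>d e = h - h e\<close>
    gives \<open>\<i>(d + L) e = h - g e\<close>, that is \<open>e = f e\<close>. The map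
    \<open>f\<close> contracts by \<open>r / (d + L)\<close>, and this choice of \<open>L\<close>
    gives \<open>r^2 = d L + L^2\<close>, which is less than \<open>(d + L)^2\<close>.\<close>
  define L where "L = (nrm A h)\<^sup>2 / d"
  define r where "r = sqrt ((nrm A h)\<^sup>2 + L\<^sup>2)"
  define c where "c = 1 / (\<i> * complex_of_real (d + L))"
  define g where "g = (\<lambda>x. h \<otimes> x \<ominus> (\<i> * complex_of_real L) \<odot> x)"
  define f where "f = (\<lambda>x. c \<odot> (h \<ominus> g x))"
  have L: "0 \<le> L" using d by (simp add: L_def)
  have r0: "0 \<le> r" by (simp add: r_def)
  have "(nrm A h)\<^sup>2 + L\<^sup>2 < (d + L)\<^sup>2"
  proof -
    have "(nrm A h)\<^sup>2 = d * L" using d by (simp add: L_def)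
    moreover have "0 < d * d" "0 \<le> d * L" using d L by simp_all
    ultimately show ?thesis by (simp add: power2_eq_square algebra_simps)
  qed
  then have "r < d + L"
    unfolding r_def using d L by (intro real_less_lsqrt) auto
  then have q: "0 \<le> r / (d + L)" "r / (d + L) < 1"
    using d L r0 by simp_all
  have cmod_c: "cmod c = 1 / (d + L)"
    using d L by (simp add: c_def norm_divide norm_mult del: of_real_add)
  have gI: "g x \<in> I" if "x \<in> I" for x
    unfolding g_def using that h sub
    by (intro S.closed_ideal_minus[OF I] closed_ideal_mult_left[OF I] closed_ideal_smult[OF I]) auto
  have fI: "f ` I \<subseteq> I"
    unfolding f_def using gI h
    by (auto intro!: closed_ideal_smult[OF I] S.closed_ideal_minus[OF I])
  have contr: "cdist A (f x) (f y) \<le> r / (d + L) * cdist A x y" if xy: "x \<in> I" "y \<in> I" for x y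
  proof -
    have A: "x \<in> carrier A" "y \<in> carrier A" "g x \<in> carrier A" "g y \<in> carrier A"
        "f x \<in> carrier A" "f y \<in> carrier A"
      using xy gI sub fI by auto
    have gm: "g x \<ominus> g y = g (x \<ominus> y)"
      unfolding g_def using A(1,2) hA
      by (simp add: S.mult_minus_right M.minus_eq M.minus_add M.a_ac S.smult_add_right
          S.mult_r_distr S.r_minus S.smult_minus_1[symmetric] S.smult_smult S.smult_mult_right mult.commute)
    have "f x \<ominus> f y = c \<odot> (g y \<ominus> g x)"
      unfolding f_def using A(3,4) hA
      by (simp add: S.smult_minus[symmetric] S.minus_minus_minus)
    then have "nrm A (f x \<ominus> f y) = nrm A (g (x \<ominus> y)) / (d + L)"
      using A d L by (simp add: S.nrm_smult cmod_c gm[symmetric] S.nrm_minus_commute)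
    also have "\<dots> \<le> r * nrm A (x \<ominus> y) / (d + L)"
      unfolding g_def r_def using A hA h L d
      by (intro divide_right_mono nrm_shift_le) auto
    finally show ?thesis
      using A by (simp add: cdist_def)
  qed
  have "I \<noteq> {}" using h by blast
  then obtain e where e: "e \<in> I" "f e = e"
    using MS.Banach_fixpoint_closedin[OF complete closed_ideal_closedin[OF I] _ fI q contr]
    by blast
  have eA: "e \<in> carrier A" "h \<otimes> e \<in> carrier A" using e sub hA by auto
  have "(\<i> * complex_of_real (d + L)) * c = 1"
    using d L by (simp add: c_def del: of_real_add)
  then have "(\<i> * complex_of_real (d + L)) \<odot> (c \<odot> (h \<ominus> g e)) = h \<ominus> g e"
    using gI[OF e(1)] sub hA by (simp add: S.smult_smult)
  then have "(\<i> * complex_of_real (d + L)) \<odot> e = h \<ominus> g e"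
    using e(2) by (simp add: f_def)
  then have "(\<i> * complex_of_real d) \<odot> e \<oplus> (\<i> * complex_of_real L) \<odot> e = h \<ominus> g e"
    using eA by (simp add: distrib_left S.smult_add_left)
  also have "\<dots> = (h \<ominus> h \<otimes> e) \<oplus> (\<i> * complex_of_real L) \<odot> e"
    unfolding g_def using eA hA by (simp add: M.minus_eq M.minus_add M.a_ac)
  finally have "(\<i> * complex_of_real d) \<odot> e = h \<ominus> h \<otimes> e"
    using eA hA by simp
  then have "h \<otimes> e \<oplus> (\<i> * complex_of_real d) \<odot> e = h"
    using eA hA S.minus_add_cancel[of h "h \<otimes> e"] by (simp add: M.a_comm)
  then show ?thesis
    using e by blast
qed

text \<open>
  With \<open>h = x\<^sup>*x\<close> and \<open>e = h (h + \<i>d)\<^sup>-\<^sup>1\<close> one has \<open>e + e\<^sup>* = 2 e\<^sup>*e\<close>, which forces \<open>\<parallel>e\<parallel> \<le> 1\<close>, and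
  \<open>x\<^sup>*(x - xe) = h - he = \<i>de\<close>.
\<close>

lemma (in cstar_algebra) ex_approximate_unit:
  assumes I: "closed_ideal I A" and x: "x \<in> carrier A" "adj A x \<otimes> x \<in> I" and \<delta>: "0 < \<delta>"
  shows "\<exists>e\<in>I. adj A e \<in> I \<and> nrm A e \<le> 1 \<and> nrm A (x \<ominus> x \<otimes> e) < \<delta>"
proof -
  interpret S: star_algebra A by (rule star_algebra)
  have sub: "\<And>x. x \<in> I \<Longrightarrow> x \<in> carrier A"
    using S.closed_ideal_subset[OF I] by auto
  define h where "h = adj A x \<otimes> x"
  have h: "h \<in> I" "adj A h = h" "h \<in> carrier A"
    using x by (simp_all add: h_def S.adj_mult)
  \<comment> \<open>The estimate at the end is \<open>(nrm A z)^2 \<le> 2 d\<close>, so any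
    \<open>d\<close> below half of the square of \<delta> would do.\<close>
  define d where "d = \<delta>\<^sup>2 / 4"
  have d: "0 < d" using \<delta> by (simp add: d_def)
  define t where "t = \<i> * complex_of_real d"
  have t: "t \<noteq> 0" "cnj t = - t" "cmod t = d"
    using d by (simp_all add: t_def norm_mult)
  obtain e where e: "e \<in> I" "h \<otimes> e \<oplus> t \<odot> e = h"
    using ex_resolvent[OF I h(1,2) d] by (auto simp: t_def)
  define e' where "e' = adj A e"
  define q where "q = e' \<otimes> e"
  define P where "P = e' \<otimes> (h \<otimes> e)"
  have A: "e \<in> carrier A" "e' \<in> carrier A" "q \<in> carrier A" "P \<in> carrier A"
    using sub e h by (simp_all add: e'_def q_def P_def)
  have e'h: "e' \<otimes> h \<oplus> (- t) \<odot> e' = h"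
    using arg_cong[OF e(2), of "adj A"] A h t by (simp add: S.adj_add S.adj_mult S.adj_smult e'_def)
  \<comment> \<open>Multiplying the equation for \<open>e\<close> by \<open>e'\<close> on the left,
    and its adjoint by \<open>e\<close> on the right, produces the same term \<open>P\<close>.
    Equating the two expressions for \<open>h\<close>, cancelling \<open>P\<close> and dividing by
    \<open>t\<close> yields \<open>e + e' = q + q\<close>.\<close>
  have P1: "P \<oplus> t \<odot> q = e' \<otimes> h"
    using arg_cong[OF e(2), of "\<lambda>u. e' \<otimes> u"] A h
    by (simp add: S.mult_r_distr S.smult_mult_right P_def q_def)
  have P2: "P \<oplus> (- t) \<odot> q = h \<otimes> e"
    using arg_cong[OF e'h, of "\<lambda>u. u \<otimes> e"] A h
    by (simp add: S.mult_l_distr S.smult_mult_left S.mult_assoc P_def q_def)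
  have "P \<oplus> ((- t) \<odot> q \<oplus> t \<odot> e) = P \<oplus> (t \<odot> q \<oplus> (- t) \<odot> e')"
    using e(2) e'h A by (simp add: P1[symmetric] P2[symmetric] M.a_assoc)
  then have "(- t) \<odot> q \<oplus> t \<odot> e = t \<odot> q \<oplus> (- t) \<odot> e'"
    using A by simp
  then have "(1 / t) \<odot> ((- t) \<odot> q \<oplus> t \<odot> e) = (1 / t) \<odot> (t \<odot> q \<oplus> (- t) \<odot> e')"
    by simp
  then have qe: "\<ominus> q \<oplus> e = q \<oplus> \<ominus> e'"
    using A t by (simp add: S.smult_add_right S.smult_smult S.smult_minus_1)
  have "e \<oplus> e' = q \<oplus> (\<ominus> q \<oplus> e) \<oplus> e'"
    using A by (simp add: M.a_assoc[symmetric] M.r_neg)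
  also have "\<dots> = q \<oplus> q"
    using A by (simp add: qe M.a_assoc M.l_neg)
  finally have eq: "e \<oplus> e' = q \<oplus> q" .
  have "2 * nrm A q = nrm A (2 \<odot> q)"
    using A by (simp add: S.nrm_smult)
  also have "2 \<odot> q = e \<oplus> e'"
    using A S.smult_add_left[of q 1 1] by (simp add: eq)
  also have "nrm A \<dots> \<le> 2 * nrm A e"
    using A S.nrm_triangle[of e e'] S.nrm_adj[of e] by (simp add: e'_def)
  finally have "(nrm A e)\<^sup>2 \<le> nrm A e"
    using A nrm_adj_mult[of e] by (simp add: q_def e'_def)
  then have e1: "nrm A e \<le> 1"
    using S.nrm_nonneg[OF A(1)] mult_le_cancel_right[of "nrm A e" "nrm A e" 1]
    unfolding power2_eq_square by linarith
  define z where "z = x \<ominus> x \<otimes> e"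
  have z: "z \<in> carrier A" using x A by (simp add: z_def)
  have w: "adj A x \<otimes> z = t \<odot> e"
  proof -
    have "adj A x \<otimes> z = h \<ominus> h \<otimes> e"
      using x A by (simp add: z_def h_def S.mult_minus_right S.mult_assoc)
    also have "\<dots> = (t \<odot> e \<oplus> h \<otimes> e) \<ominus> h \<otimes> e"
      using e(2) A h by (simp add: M.a_comm)
    also have "\<dots> = t \<odot> e"
      using A h by (simp add: S.add_minus_cancel)
    finally show ?thesis .
  qed
  \<comment> \<open>The factor \<open>adj A z\<close> is \<open>adj A x - e' adj A x\<close>, so
    \<open>adj A x \<otimes> z = t \<odot> e\<close> can be used twice; since \<open>e\<close> has
    norm at most 1, both terms have norm at most \<open>d\<close>.\<close>
  have "adj A z \<otimes> z = t \<odot> e \<ominus> e' \<otimes> (t \<odot> e)"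
  proof -
    have "adj A z = adj A x \<ominus> e' \<otimes> adj A x"
      using x A by (simp add: z_def S.adj_minus S.adj_mult e'_def)
    then show ?thesis
      using x A z by (simp add: S.mult_minus_left S.mult_assoc w)
  qed
  then have "(nrm A z)\<^sup>2 \<le> nrm A (t \<odot> e) + nrm A (e' \<otimes> (t \<odot> e))"
    using nrm_adj_mult[OF z] A S.nrm_minus_le[of "t \<odot> e" "e' \<otimes> (t \<odot> e)"] by simp
  also have "\<dots> \<le> nrm A (t \<odot> e) + nrm A e' * nrm A (t \<odot> e)"
    using A S.nrm_mult[of e' "t \<odot> e"] by simp
  also have "\<dots> \<le> d + 1 * d"
    using A e1 d S.nrm_adj[of e]
    by (intro add_mono mult_mono) (auto simp: S.nrm_smult t e'_def mult_le_cancel_left1)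
  also have "\<dots> < \<delta>\<^sup>2"
    using \<delta> by (simp add: d_def)
  finally have "nrm A z < \<delta>"
    using \<delta> by (meson less_le power_less_imp_less_base)
  \<comment> \<open>Closure of \<open>I\<close> under the involution is itself derived from this
    lemma, so \<open>e'\<close> is placed in \<open>I\<close> by solving the adjoint equation for
    it.\<close>
  moreover have "e' \<in> I"
  proof -
    have "(-t) \<odot> e' = h \<ominus> e' \<otimes> h"
      using e'h A h S.add_minus_cancel[of "(-t) \<odot> e'" "e' \<otimes> h"] by (simp add: M.a_comm)
    moreover have "h \<ominus> e' \<otimes> h \<in> I"
      using h A by (intro S.closed_ideal_minus[OF I] closed_ideal_mult_left[OF I])
    ultimately have "(- 1 / t) \<odot> ((- t) \<odot> e') \<in> I"
      using closed_ideal_smult[OF I] by metis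
    then show ?thesis
      using A t by (simp add: S.smult_smult)
  qed
  ultimately show ?thesis
    using e e1 by (auto simp: e'_def z_def)
qed

text \<open>The approximate unit is taken for \<open>adj A x\<close>, not yet known to lie in
  \<open>I\<close>; it is enough that \<open>x \<otimes> adj A x\<close> does. This is why
  \<open>ex_approximate_unit\<close> assumes \<open>adj A x \<otimes> x \<in> I\<close> rather than
  \<open>x \<in> I\<close>. Then \<open>adj A x\<close> is a limit of products with a factor from
  \<open>I\<close>.\<close>

lemma (in cstar_algebra) closed_ideal_adj:
  assumes I: "closed_ideal I A" and x: "x \<in> I"
  shows "adj A x \<in> I"
proof (rule star_algebra.closed_ideal_approx[OF star_algebra I])
  interpret S: star_algebra A by (rule star_algebra)
  have xA: "x \<in> carrier A" using S.closed_ideal_subset[OF I] x by auto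
  then show "adj A x \<in> carrier A" by simp
  fix \<delta> :: real assume "0 < \<delta>"
  moreover have "adj A (adj A x) \<otimes> adj A x \<in> I"
    using xA x closed_ideal_mult_right[OF I] by simp
  ultimately obtain e where "e \<in> I" "nrm A (adj A x \<ominus> adj A x \<otimes> e) < \<delta>"
    using ex_approximate_unit[OF I, of "adj A x" \<delta>] xA by auto
  then show "\<exists>i\<in>I. nrm A (adj A x \<ominus> i) < \<delta>"
    using xA closed_ideal_mult_left[OF I] by (meson S.adj_closed)
qed

lemma (in cstar_algebra) ex_approximate_unit_right:
  assumes I: "closed_ideal I A" and x: "x \<in> I" and \<delta>: "0 < \<delta>"
  shows "\<exists>e\<in>I. nrm A e \<le> 1 \<and> nrm A (x \<ominus> x \<otimes> e) < \<delta>"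
proof -
  interpret S: star_algebra A by (rule star_algebra)
  have "x \<in> carrier A" "adj A x \<otimes> x \<in> I"
    using S.closed_ideal_subset[OF I] x closed_ideal_mult_left[OF I] by auto
  then show ?thesis
    using ex_approximate_unit[OF I _ _ \<delta>, of x] by blast
qed

text \<open>The involution exchanges the two sides: the unit is the adjoint of a right one for
  \<open>adj A x\<close>.\<close>

lemma (in cstar_algebra) ex_approximate_unit_left:
  assumes I: "closed_ideal I A" and x: "x \<in> I" and \<delta>: "0 < \<delta>"
  shows "\<exists>e\<in>I. nrm A e \<le> 1 \<and> nrm A (x \<ominus> e \<otimes> x) < \<delta>"
proof -
  interpret S: star_algebra A by (rule star_algebra)
  have xA: "x \<in> carrier A" using S.closed_ideal_subset[OF I] x by auto
  obtain e where e: "e \<in> I" "nrm A e \<le> 1" "nrm A (adj A x \<ominus> adj A x \<otimes> e) < \<delta>"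
    using ex_approximate_unit_right[OF I closed_ideal_adj[OF I x] \<delta>] by blast
  have eA: "e \<in> carrier A" using S.closed_ideal_subset[OF I] e by auto
  have "adj A (adj A x \<ominus> adj A x \<otimes> e) = x \<ominus> adj A e \<otimes> x"
    using xA eA by (simp add: S.adj_minus S.adj_mult)
  then have "nrm A (x \<ominus> adj A e \<otimes> x) < \<delta>"
    using e(3) S.nrm_adj[of "adj A x \<ominus> adj A x \<otimes> e"] xA eA by simp
  then show ?thesis
    using e closed_ideal_adj[OF I] S.nrm_adj[OF eA] by metis
qed

text \<open>Specialises the results on ideals to \<open>A\<close> itself, whose approximate units
  are later pushed to \<open>A/I\<close>.\<close>

lemma (in cstar_algebra) closed_ideal_carrier: "closed_ideal (carrier A) A"
proof -
  interpret S: star_algebra A by (rule star_algebra)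
  interpret MS: Metric_space "carrier A" "cdist A"
    by (rule S.Metric_space_cdist)
  have "additive_subgroup (carrier A) A"
    by (auto simp: additive_subgroup_def intro!: M.add.subgroupI)
  then show ?thesis
    by (auto simp: closed_ideal_def MS.closedin_metric)
qed

section \<open>The ring of multipliers\<close>

lemma multiplier_algebra_simps [simp]:
  "carrier (multiplier_algebra A) = double_centralizers A"
  "(L1, R1) \<otimes>\<^bsub>multiplier_algebra A\<^esub> (L2, R2)
     = (compose (carrier A) L1 L2, compose (carrier A) R2 R1)"
  "\<one>\<^bsub>multiplier_algebra A\<^esub> = (\<lambda>x\<in>carrier A. x, \<lambda>x\<in>carrier A. x)"
  "\<zero>\<^bsub>multiplier_algebra A\<^esub> = (\<lambda>x\<in>carrier A. \<zero>\<^bsub>A\<^esub>, \<lambda>x\<in>carrier A. \<zero>\<^bsub>A\<^esub>)"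
  "(L1, R1) \<oplus>\<^bsub>multiplier_algebra A\<^esub> (L2, R2)
     = (\<lambda>x\<in>carrier A. L1 x \<oplus>\<^bsub>A\<^esub> L2 x, \<lambda>x\<in>carrier A. R1 x \<oplus>\<^bsub>A\<^esub> R2 x)"
  "adj (multiplier_algebra A) (L, R)
     = (\<lambda>x\<in>carrier A. adj A (R (adj A x)), \<lambda>x\<in>carrier A. adj A (L (adj A x)))"
  "nrm (multiplier_algebra A) (L, R) = (SUP x\<in>{x \<in> carrier A. nrm A x \<le> 1}. nrm A (L x))"
  by (simp_all add: multiplier_algebra_def)

section \<open>Bounded operators on the algebra\<close>

lemma bounded_operatorD:
  assumes "bounded_operator A T"
  shows bounded_operator_closed: "x \<in> carrier A \<Longrightarrow> T x \<in> carrier A"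
    and bounded_operator_undefined: "x \<notin> carrier A \<Longrightarrow> T x = undefined"
    and bounded_operator_add:
      "\<lbrakk>x \<in> carrier A; y \<in> carrier A\<rbrakk> \<Longrightarrow> T (x \<oplus>\<^bsub>A\<^esub> y) = T x \<oplus>\<^bsub>A\<^esub> T y"
    and bounded_operator_smult: "x \<in> carrier A \<Longrightarrow> T (c \<odot>\<^bsub>A\<^esub> x) = c \<odot>\<^bsub>A\<^esub> T x"
  using assms by (auto simp: bounded_operator_def PiE_def extensional_def)

context star_algebra
begin

lemma bounded_operator_bound:
  assumes "bounded_operator A T"
  obtains K where "0 \<le> K" "\<And>x. x \<in> carrier A \<Longrightarrow> nrm A (T x) \<le> K * nrm A x"
proof -
  obtain K where K: "\<And>x. x \<in> carrier A \<Longrightarrow> nrm A (T x) \<le> K * nrm A x"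
    using assms unfolding bounded_operator_def by blast
  \<comment> \<open>The definition does not fix the sign of \<open>K\<close>; a nonnegative bound is
    wanted because later estimates multiply inequalities by it.\<close>
  have "nrm A (T x) \<le> \<bar>K\<bar> * nrm A x" if "x \<in> carrier A" for x
    using K[OF that] that mult_right_mono[of K "\<bar>K\<bar>" "nrm A x"] nrm_nonneg[of x] by linarith
  then show thesis
    using that[of "\<bar>K\<bar>"] by simp
qed

lemma bounded_operatorI:
  assumes "T \<in> extensional (carrier A)"
    and "\<And>x. x \<in> carrier A \<Longrightarrow> T x \<in> carrier A"
    and "\<And>x y. \<lbrakk>x \<in> carrier A; y \<in> carrier A\<rbrakk> \<Longrightarrow> T (x \<oplus> y) = T x \<oplus> T y"
    and "\<And>c x. x \<in> carrier A \<Longrightarrow> T (c \<odot> x) = c \<odot> T x"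
    and "\<And>x. x \<in> carrier A \<Longrightarrow> nrm A (T x) \<le> K * nrm A x"
  shows "bounded_operator A T"
  unfolding bounded_operator_def
proof (intro conjI ballI allI)
  show "T \<in> carrier A \<rightarrow>\<^sub>E carrier A"
    using assms(1,2) by (simp add: PiE_def Pi_def)
  show "\<exists>K. \<forall>x\<in>carrier A. nrm A (T x) \<le> K * nrm A x"
    using assms(5) by (intro exI[of _ K]) simp
qed (simp_all add: assms(3,4))

lemma bounded_operator_minus:
  assumes T: "bounded_operator A T" and "x \<in> carrier A" "y \<in> carrier A"
  shows "T (x \<ominus> y) = T x \<ominus> T y"
  using bounded_operator_smult[OF T, of y "-1"] assms(2,3)
  by (simp add: M.minus_eq bounded_operatorD(1,3)[OF T] smult_minus_1)

lemma bounded_operator_compose: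
  assumes S: "bounded_operator A S" and T: "bounded_operator A T"
  shows "bounded_operator A (compose (carrier A) S T)"
proof -
  obtain K1 where K1: "0 \<le> K1" "\<And>x. x \<in> carrier A \<Longrightarrow> nrm A (S x) \<le> K1 * nrm A x"
    using bounded_operator_bound[OF S] by blast
  obtain K2 where K2: "\<And>x. x \<in> carrier A \<Longrightarrow> nrm A (T x) \<le> K2 * nrm A x"
    using bounded_operator_bound[OF T] by blast
  have "nrm A (S (T x)) \<le> K1 * K2 * nrm A x" if x: "x \<in> carrier A" for x
    using K1(2)[of "T x"] mult_left_mono[OF K2[OF x] K1(1)] x by (simp add: mult.assoc bounded_operatorD[OF T])
  then show ?thesis
    by (intro bounded_operatorI[where K = "K1 * K2"])
      (auto simp: compose_def bounded_operatorD[OF S] bounded_operatorD[OF T])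
qed

lemma bounded_operator_plus:
  assumes S: "bounded_operator A S" and T: "bounded_operator A T"
  shows "bounded_operator A (\<lambda>x\<in>carrier A. S x \<oplus> T x)"
proof -
  obtain K1 where K1: "\<And>x. x \<in> carrier A \<Longrightarrow> nrm A (S x) \<le> K1 * nrm A x"
    using bounded_operator_bound[OF S] by blast
  obtain K2 where K2: "\<And>x. x \<in> carrier A \<Longrightarrow> nrm A (T x) \<le> K2 * nrm A x"
    using bounded_operator_bound[OF T] by blast
  have "nrm A (S x \<oplus> T x) \<le> (K1 + K2) * nrm A x" if x: "x \<in> carrier A" for x
    using nrm_triangle[of "S x" "T x"] K1[OF x] K2[OF x] x
    by (simp add: distrib_right bounded_operatorD[OF S] bounded_operatorD[OF T])
  then show ?thesis
    by (intro bounded_operatorI[where K = "K1 + K2"])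
      (auto simp: bounded_operatorD[OF S] bounded_operatorD[OF T] smult_add_right M.a_ac)
qed

lemma bounded_operator_uminus:
  assumes T: "bounded_operator A T"
  shows "bounded_operator A (\<lambda>x\<in>carrier A. \<ominus> T x)"
proof -
  obtain K where K: "\<And>x. x \<in> carrier A \<Longrightarrow> nrm A (T x) \<le> K * nrm A x"
    using bounded_operator_bound[OF T] by blast
  then show ?thesis
    by (intro bounded_operatorI[where K = K])
      (auto simp: bounded_operatorD[OF T] M.minus_add nrm_smult
        smult_minus_1[symmetric] smult_add_right smult_smult)
qed

lemma bounded_operator_id: "bounded_operator A (\<lambda>x\<in>carrier A. x)"
  by (rule bounded_operatorI[where K = 1]) auto

lemma bounded_operator_zero: "bounded_operator A (\<lambda>x\<in>carrier A. \<zero>)"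
  by (rule bounded_operatorI[where K = 0]) auto

lemma bounded_operator_mult_left:
  assumes "a \<in> carrier A"
  shows "bounded_operator A (\<lambda>x\<in>carrier A. a \<otimes> x)"
  using assms nrm_mult
  by (intro bounded_operatorI[where K = "nrm A a"])
    (auto simp: mult_r_distr smult_mult_right)

lemma bounded_operator_mult_right:
  assumes "a \<in> carrier A"
  shows "bounded_operator A (\<lambda>x\<in>carrier A. x \<otimes> a)"
  using assms nrm_mult
  by (intro bounded_operatorI[where K = "nrm A a"])
    (auto simp: mult_l_distr smult_mult_left mult.commute)

section \<open>Double centralizers form a ring\<close>

lemma double_centralizersI:
  assumes "bounded_operator A L" "bounded_operator A R"
    and "\<And>x y. \<lbrakk>x \<in> carrier A; y \<in> carrier A\<rbrakk> \<Longrightarrow> L (x \<otimes> y) = L x \<otimes> y"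
    and "\<And>x y. \<lbrakk>x \<in> carrier A; y \<in> carrier A\<rbrakk> \<Longrightarrow> R (x \<otimes> y) = x \<otimes> R y"
    and "\<And>x y. \<lbrakk>x \<in> carrier A; y \<in> carrier A\<rbrakk> \<Longrightarrow> R x \<otimes> y = x \<otimes> L y"
  shows "(L, R) \<in> double_centralizers A"
  using assms by (simp add: double_centralizers_def)

lemma double_centralizersD:
  assumes "(L, R) \<in> double_centralizers A"
  shows "bounded_operator A L" "bounded_operator A R"
    and "\<lbrakk>x \<in> carrier A; y \<in> carrier A\<rbrakk> \<Longrightarrow> L (x \<otimes> y) = L x \<otimes> y"
    and "\<lbrakk>x \<in> carrier A; y \<in> carrier A\<rbrakk> \<Longrightarrow> R (x \<otimes> y) = x \<otimes> R y"
    and "\<lbrakk>x \<in> carrier A; y \<in> carrier A\<rbrakk> \<Longrightarrow> R x \<otimes> y = x \<otimes> L y"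
  using assms by (simp_all add: double_centralizers_def)

lemma multiplier_mult_closed:
  assumes "m \<in> double_centralizers A" "n \<in> double_centralizers A"
  shows "m \<otimes>\<^bsub>multiplier_algebra A\<^esub> n \<in> double_centralizers A"
proof -
  obtain L1 R1 L2 R2 where mn: "m = (L1, R1)" "n = (L2, R2)" by fastforce
  note 1 = double_centralizersD[OF assms(1)[unfolded mn]]
    and 2 = double_centralizersD[OF assms(2)[unfolded mn]]
  note bo = bounded_operatorD[OF 1(1)] bounded_operatorD[OF 1(2)]
    bounded_operatorD[OF 2(1)] bounded_operatorD[OF 2(2)]
  show ?thesis
    unfolding mn multiplier_algebra_simps
    using 1(1,2) 2(1,2) bounded_operator_compose
    by (intro double_centralizersI) (simp_all add: bo compose_def 1(3-5) 2(3-5))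
qed

lemma multiplier_add_closed:
  assumes "m \<in> double_centralizers A" "n \<in> double_centralizers A"
  shows "m \<oplus>\<^bsub>multiplier_algebra A\<^esub> n \<in> double_centralizers A"
proof -
  obtain L1 R1 L2 R2 where mn: "m = (L1, R1)" "n = (L2, R2)" by fastforce
  note 1 = double_centralizersD[OF assms(1)[unfolded mn]]
    and 2 = double_centralizersD[OF assms(2)[unfolded mn]]
  note bo = bounded_operatorD[OF 1(1)] bounded_operatorD[OF 1(2)]
    bounded_operatorD[OF 2(1)] bounded_operatorD[OF 2(2)]
  show ?thesis
    unfolding mn multiplier_algebra_simps
    using 1(1,2) 2(1,2) bounded_operator_plus
    by (intro double_centralizersI)
      (simp_all add: bo 1(3-5) 2(3-5) mult_l_distr mult_r_distr)
qed

lemma multiplier_one_closed: "\<one>\<^bsub>multiplier_algebra A\<^esub> \<in> double_centralizers A"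
  using bounded_operator_id by (auto intro!: double_centralizersI)

lemma multiplier_zero_closed: "\<zero>\<^bsub>multiplier_algebra A\<^esub> \<in> double_centralizers A"
  using bounded_operator_zero by (auto intro!: double_centralizersI)

text \<open>Bounded operators take the value \<open>undefined\<close> off the carrier, so each ring
  law is a pointwise identity in both components, with \<open>bounded_operator_undefined\<close>
  settling the points outside.\<close>

lemma ring_multiplier_algebra: "ring (multiplier_algebra A)"
proof (intro ringI abelian_groupI monoidI, unfold multiplier_algebra_simps(1))
  let ?M = "multiplier_algebra A"
  note ext = fun_eq_iff restrict_def compose_def M.a_ac
  show "\<exists>n\<in>double_centralizers A. n \<oplus>\<^bsub>?M\<^esub> m = \<zero>\<^bsub>?M\<^esub>"
    if m: "m \<in> double_centralizers A" for m
  proof -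
    obtain L R where mLR: "m = (L, R)" by fastforce
    note 1 = double_centralizersD[OF m[unfolded mLR]]
    note bo = bounded_operatorD[OF 1(1)] bounded_operatorD[OF 1(2)]
    have "(\<lambda>x\<in>carrier A. \<ominus> L x, \<lambda>x\<in>carrier A. \<ominus> R x) \<in> double_centralizers A"
      using 1(1,2) bounded_operator_uminus
      by (intro double_centralizersI) (simp_all add: bo 1(3-5) l_minus r_minus)
    moreover have "(\<lambda>x\<in>carrier A. \<ominus> L x, \<lambda>x\<in>carrier A. \<ominus> R x) \<oplus>\<^bsub>?M\<^esub> m = \<zero>\<^bsub>?M\<^esub>"
      by (auto simp: mLR ext bo M.r_neg)
    ultimately show ?thesis by blast
  qed
  fix m n k assume "m \<in> double_centralizers A" "n \<in> double_centralizers A"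
    "k \<in> double_centralizers A"
  moreover obtain L1 R1 L2 R2 L3 R3 where mnk: "m = (L1, R1)" "n = (L2, R2)" "k = (L3, R3)"
    by (metis surj_pair)
  ultimately have "bounded_operator A L1" "bounded_operator A L2" "bounded_operator A L3"
    "bounded_operator A R1" "bounded_operator A R2" "bounded_operator A R3"
    using double_centralizersD(1,2) by blast+
  note bo = this[THEN bounded_operator_closed] this[THEN bounded_operator_undefined]
    this[THEN bounded_operator_add]
  show "(m \<oplus>\<^bsub>?M\<^esub> n) \<oplus>\<^bsub>?M\<^esub> k = m \<oplus>\<^bsub>?M\<^esub> (n \<oplus>\<^bsub>?M\<^esub> k)"
    "m \<oplus>\<^bsub>?M\<^esub> n = n \<oplus>\<^bsub>?M\<^esub> m" "\<zero>\<^bsub>?M\<^esub> \<oplus>\<^bsub>?M\<^esub> m = m"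
    "(m \<otimes>\<^bsub>?M\<^esub> n) \<otimes>\<^bsub>?M\<^esub> k = m \<otimes>\<^bsub>?M\<^esub> (n \<otimes>\<^bsub>?M\<^esub> k)"
    "\<one>\<^bsub>?M\<^esub> \<otimes>\<^bsub>?M\<^esub> m = m" "m \<otimes>\<^bsub>?M\<^esub> \<one>\<^bsub>?M\<^esub> = m"
    "(m \<oplus>\<^bsub>?M\<^esub> n) \<otimes>\<^bsub>?M\<^esub> k = m \<otimes>\<^bsub>?M\<^esub> k \<oplus>\<^bsub>?M\<^esub> n \<otimes>\<^bsub>?M\<^esub> k"
    "k \<otimes>\<^bsub>?M\<^esub> (m \<oplus>\<^bsub>?M\<^esub> n) = k \<otimes>\<^bsub>?M\<^esub> m \<oplus>\<^bsub>?M\<^esub> k \<otimes>\<^bsub>?M\<^esub> n"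
    unfolding mnk by (auto simp: ext bo)
qed (fact multiplier_add_closed multiplier_mult_closed multiplier_one_closed
    multiplier_zero_closed)+

lemma multiplier_adj_add:
  assumes "m \<in> double_centralizers A" "n \<in> double_centralizers A"
  shows "adj (multiplier_algebra A) (m \<oplus>\<^bsub>multiplier_algebra A\<^esub> n)
      = adj (multiplier_algebra A) m \<oplus>\<^bsub>multiplier_algebra A\<^esub> adj (multiplier_algebra A) n"
proof -
  obtain L1 R1 L2 R2 where mn: "m = (L1, R1)" "n = (L2, R2)" by fastforce
  then have "bounded_operator A L1" "bounded_operator A L2"
    "bounded_operator A R1" "bounded_operator A R2"
    using double_centralizersD(1,2) assms by blast+
  note bo = this[THEN bounded_operator_closed]
  show ?thesis
    by (auto simp: mn bo fun_eq_iff restrict_def adj_add)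
qed

lemma self_adjoint_multiplier_add:
  "\<lbrakk>m \<in> self_adjoint (multiplier_algebra A); n \<in> self_adjoint (multiplier_algebra A)\<rbrakk> \<Longrightarrow>
    m \<oplus>\<^bsub>multiplier_algebra A\<^esub> n \<in> self_adjoint (multiplier_algebra A)"
  by (auto simp: self_adjoint_def multiplier_adj_add multiplier_add_closed)

section \<open>The embedding of the algebra into its multipliers\<close>

lemma multiplier_embedding_closed:
  "a \<in> carrier A \<Longrightarrow> multiplier_embedding A a \<in> double_centralizers A"
  unfolding multiplier_embedding_def
  by (intro double_centralizersI bounded_operator_mult_left bounded_operator_mult_right)
    (simp_all add: mult_assoc)

lemma multiplier_embedding_add:
  "\<lbrakk>a \<in> carrier A; b \<in> carrier A\<rbrakk> \<Longrightarrow> multiplier_embedding A (a \<oplus> b)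
    = multiplier_embedding A a \<oplus>\<^bsub>multiplier_algebra A\<^esub> multiplier_embedding A b"
  by (auto simp: multiplier_embedding_def fun_eq_iff restrict_def mult_l_distr mult_r_distr)

lemma multiplier_embedding_adj:
  "a \<in> carrier A \<Longrightarrow>
    multiplier_embedding A (adj A a) = adj (multiplier_algebra A) (multiplier_embedding A a)"
  by (auto simp: multiplier_embedding_def fun_eq_iff restrict_def adj_mult)

lemma multiplier_embedding_zero: "multiplier_embedding A \<zero> = \<zero>\<^bsub>multiplier_algebra A\<^esub>"
  by (auto simp: multiplier_embedding_def fun_eq_iff restrict_def)

lemma multiplier_embedding_uminus:
  assumes "a \<in> carrier A"
  shows "multiplier_embedding A (\<ominus> a) = \<ominus>\<^bsub>multiplier_algebra A\<^esub> multiplier_embedding A a"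
proof -
  interpret RM: ring "multiplier_algebra A" by (rule ring_multiplier_algebra)
  have "multiplier_embedding A (\<ominus> a) \<oplus>\<^bsub>multiplier_algebra A\<^esub> multiplier_embedding A a
      = \<zero>\<^bsub>multiplier_algebra A\<^esub>"
    using assms multiplier_embedding_add[of "\<ominus> a" a]
    by (simp only: multiplier_embedding_zero M.l_neg M.a_inv_closed)
  then show ?thesis
    using assms multiplier_embedding_closed
    by (metis M.a_inv_closed RM.minus_equality multiplier_algebra_simps(1))
qed

text \<open>With \<open>L x = m x\<close> and \<open>R x = x m\<close> in mind, this is the reason
  that \<open>A\<close> is an ideal of \<open>M(A)\<close>: multiplying by \<open>m\<close> on
  either side amounts to applying \<open>L\<close> or \<open>R\<close>.\<close>

lemma multiplier_mult_embedding:
  assumes "(L, R) \<in> double_centralizers A" "a \<in> carrier A"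
  shows "(L, R) \<otimes>\<^bsub>multiplier_algebra A\<^esub> multiplier_embedding A a
      = multiplier_embedding A (L a)"
    and "multiplier_embedding A a \<otimes>\<^bsub>multiplier_algebra A\<^esub> (L, R)
      = multiplier_embedding A (R a)"
  using assms(2) double_centralizersD(3-5)[OF assms(1)]
    double_centralizersD(1,2)[OF assms(1), THEN bounded_operator_closed]
  by (auto simp: multiplier_embedding_def compose_def fun_eq_iff restrict_def)

lemma nrm_multiplier_embedding_le:
  assumes "a \<in> carrier A"
  shows "nrm (multiplier_algebra A) (multiplier_embedding A a) \<le> nrm A a"
  unfolding multiplier_embedding_def multiplier_algebra_simps
proof (rule cSUP_least)
  have "nrm A \<zero> \<le> 1" by simp
  then show "{x \<in> carrier A. nrm A x \<le> 1} \<noteq> {}"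
    using M.zero_closed by blast
  fix x assume "x \<in> {x \<in> carrier A. nrm A x \<le> 1}"
  then have x: "x \<in> carrier A" "nrm A x \<le> 1" by auto
  have "nrm A (a \<otimes> x) \<le> nrm A a * nrm A x"
    using x assms by (intro nrm_mult)
  also have "\<dots> \<le> nrm A a"
    using mult_left_mono[OF x(2), of "nrm A a"] assms by simp
  finally show "nrm A ((\<lambda>x\<in>carrier A. a \<otimes> x) x) \<le> nrm A a"
    using x by simp
qed

text \<open>The supremum is tested at an approximate unit \<open>u\<close>, where
  \<open>a \<otimes> u\<close> is close to \<open>a\<close>.\<close>

lemma nrm_le_nrm_multiplier_embedding:
  assumes a: "a \<in> carrier A"
    and unit: "\<And>\<delta>. 0 < \<delta> \<Longrightarrow> \<exists>u\<in>carrier A. nrm A u \<le> 1 \<and> nrm A (a \<ominus> a \<otimes> u) < \<delta>"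
  shows "nrm A a \<le> nrm (multiplier_algebra A) (multiplier_embedding A a)"
proof (rule field_le_epsilon)
  fix \<delta> :: real assume "0 < \<delta>"
  then obtain u where u: "u \<in> carrier A" "nrm A u \<le> 1" "nrm A (a \<ominus> a \<otimes> u) < \<delta>"
    using unit by blast
  let ?f = "\<lambda>x. nrm A ((\<lambda>x\<in>carrier A. a \<otimes> x) x)"
  have "nrm A (a \<otimes> x) \<le> nrm A a" if "x \<in> carrier A" "nrm A x \<le> 1" for x
    using nrm_mult[OF a that(1)] mult_left_mono[OF that(2), of "nrm A a"] a by simp
  then have "bdd_above (?f ` {x \<in> carrier A. nrm A x \<le> 1})"
    by (intro bdd_aboveI2[of _ _ "nrm A a"]) auto
  then have "?f u \<le> (SUP x\<in>{x \<in> carrier A. nrm A x \<le> 1}. ?f x)"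
    using u by (intro cSUP_upper) auto
  then have "nrm A (a \<otimes> u) \<le> nrm (multiplier_algebra A) (multiplier_embedding A a)"
    using u by (simp add: multiplier_embedding_def)
  moreover have "nrm A a \<le> nrm A (a \<ominus> a \<otimes> u) + nrm A (a \<otimes> u)"
    using nrm_triangle[of "a \<ominus> a \<otimes> u" "a \<otimes> u"] a u by (simp add: minus_add_cancel)
  ultimately show "nrm A a \<le> nrm (multiplier_algebra A) (multiplier_embedding A a) + \<delta>"
    using u(3) by linarith
qed

text \<open>Invariance under \<open>L\<close> and \<open>R\<close> is exactly two-sided absorption
  in \<open>M(A)\<close>. It is applied to \<open>A\<close> itself, to an ideal \<open>Y\<close> and
  to the kernel of a homomorphism on \<open>Y\<close>.\<close>

lemma ideal_embedding_image:
  assumes I: "additive_subgroup I A"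
    and L: "\<And>L R a. \<lbrakk>(L, R) \<in> double_centralizers A; a \<in> I\<rbrakk> \<Longrightarrow> L a \<in> I \<and> R a \<in> I"
  shows "ideal (multiplier_embedding A ` I) (multiplier_algebra A)"
proof (rule idealI[OF ring_multiplier_algebra])
  interpret I: additive_subgroup I A by fact
  interpret RM: ring "multiplier_algebra A" by (rule ring_multiplier_algebra)
  have sub: "a \<in> carrier A" if "a \<in> I" for a
    using I.a_Hcarr that by blast
  have "I \<noteq> {}"
    using I.zero_closed by blast
  have "\<ominus> a \<in> I" if "a \<in> I" for a
    using subgroup.m_inv_closed[OF I.a_subgroup that] by (simp add: a_inv_def)
  then show "subgroup (multiplier_embedding A ` I) (add_monoid (multiplier_algebra A))"
    using sub multiplier_embedding_closed \<open>I \<noteq> {}\<close>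
    by (intro RM.add.subgroupI)
      (auto simp: multiplier_embedding_uminus[symmetric] multiplier_embedding_add[symmetric]
        intro!: imageI I.a_closed)
  show "x \<otimes>\<^bsub>multiplier_algebra A\<^esub> a \<in> multiplier_embedding A ` I"
    "a \<otimes>\<^bsub>multiplier_algebra A\<^esub> x \<in> multiplier_embedding A ` I"
    if "a \<in> multiplier_embedding A ` I" "x \<in> carrier (multiplier_algebra A)" for a x
    using that L sub
    by (cases x; auto simp: multiplier_mult_embedding[simplified])+
qed

end

section \<open>Invertibility modulo an ideal\<close>

text \<open>Allows invertibility modulo an ideal to be handled by representatives, with one
  \<open>z\<close> serving both sides; this makes it easy to push through a homomorphism.\<close>

lemma (in ideal) quotient_Units_iff:
  assumes h: "h \<in> carrier R"
  shows "I +> h \<in> Units (R Quot I) \<longleftrightarrow>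
    (\<exists>z\<in>carrier R. h \<otimes> z \<ominus> \<one> \<in> I \<and> z \<otimes> h \<ominus> \<one> \<in> I)"
proof -
  have carr: "carrier (R Quot I) = (+>) I ` carrier R"
    by (auto simp: FactRing_def A_RCOSETS_defs a_r_coset_def)
  have "(I +> h) \<otimes>\<^bsub>R Quot I\<^esub> (I +> z) = \<one>\<^bsub>R Quot I\<^esub> \<longleftrightarrow> h \<otimes> z \<ominus> \<one> \<in> I"
    "(I +> z) \<otimes>\<^bsub>R Quot I\<^esub> (I +> h) = \<one>\<^bsub>R Quot I\<^esub> \<longleftrightarrow> z \<otimes> h \<ominus> \<one> \<in> I"
    if "z \<in> carrier R" for z
    using that h quotient_eq_iff_same_a_r_cos[OF is_ideal]
    by (simp_all add: FactRing_def rcoset_mult_add)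
  then show ?thesis
    using h unfolding Units_def carr by auto
qed

text \<open>
  A two-sided inverse \<open>z\<close> of \<open>h\<close> modulo \<open>J\<close> is corrected by an element of \<open>J\<close> so that its image
  becomes the inverse of \<open>f h\<close>.
\<close>

lemma (in ring_hom_ring) quotient_Units_Int_kernel:
  assumes J: "ideal J R" and K: "ideal {x \<in> J. h x = \<zero>\<^bsub>S\<^esub>} R" and fJ: "ideal (h ` J) S"
    and a: "a \<in> carrier R" "J +> a \<in> Units (R Quot J)" "h a \<in> Units S"
  shows "{x \<in> J. h x = \<zero>\<^bsub>S\<^esub>} +> a \<in> Units (R Quot {x \<in> J. h x = \<zero>\<^bsub>S\<^esub>})"
proof -
  interpret J: ideal J R by fact
  obtain z where z: "z \<in> carrier R" "a \<otimes> z \<ominus> \<one> \<in> J" "z \<otimes> a \<ominus> \<one> \<in> J"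
    using a J.quotient_Units_iff by blast
  obtain y where y: "y \<in> carrier S" "y \<otimes>\<^bsub>S\<^esub> h a = \<one>\<^bsub>S\<^esub>" "h a \<otimes>\<^bsub>S\<^esub> y = \<one>\<^bsub>S\<^esub>"
    using a(3) by (auto simp: Units_def)
  \<comment> \<open>This element equals \<open>h z - y\<close>, the error of \<open>h z\<close> as
    an inverse of \<open>h a\<close>. As the image of \<open>J\<close> is an ideal, the error comes
    from some \<open>c\<close> in \<open>J\<close>, and \<open>z - c\<close> is then mapped to
    \<open>y\<close>.\<close>
  have "y \<otimes>\<^bsub>S\<^esub> h (a \<otimes> z \<ominus> \<one>) \<in> h ` J"
    using ideal.I_l_closed[OF fJ] z(2) y(1) by blast
  then obtain c where c: "c \<in> J" "h c = y \<otimes>\<^bsub>S\<^esub> h (a \<otimes> z \<ominus> \<one>)"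
    by auto
  have cR: "c \<in> carrier R" using c J.a_Hcarr by blast
  have "h c = (y \<otimes>\<^bsub>S\<^esub> h a) \<otimes>\<^bsub>S\<^esub> h z \<ominus>\<^bsub>S\<^esub> y"
    using a z(1) y(1) by (simp add: c(2) R.minus_eq S.minus_eq S.r_distr S.r_minus S.m_assoc)
  then have hc: "h c = h z \<ominus>\<^bsub>S\<^esub> y"
    using z y by simp
  define w where "w = z \<ominus> c"
  have w: "w \<in> carrier R" using z cR by (simp add: w_def)
  have hw: "h w = y"
    using z y cR by (simp add: w_def R.minus_eq hc S.minus_eq S.minus_add S.r_neg1 S.a_assoc[symmetric] S.r_neg)
  have "a \<otimes> w \<ominus> \<one> = (a \<otimes> z \<ominus> \<one>) \<oplus> \<ominus> (a \<otimes> c)"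
    using a z cR by (simp add: w_def R.minus_eq R.r_distr R.r_minus R.a_ac)
  moreover have "w \<otimes> a \<ominus> \<one> = (z \<otimes> a \<ominus> \<one>) \<oplus> \<ominus> (c \<otimes> a)"
    using a z cR by (simp add: w_def R.minus_eq R.l_distr R.l_minus R.a_ac)
  ultimately have "a \<otimes> w \<ominus> \<one> \<in> J" "w \<otimes> a \<ominus> \<one> \<in> J"
    using z c a J.I_l_closed J.I_r_closed by simp_all
  moreover have "h (a \<otimes> w \<ominus> \<one>) = \<zero>\<^bsub>S\<^esub>" "h (w \<otimes> a \<ominus> \<one>) = \<zero>\<^bsub>S\<^esub>"
    using a w y hw by (simp_all add: R.minus_eq S.r_neg)
  ultimately show ?thesis
    using ideal.quotient_Units_iff[OF K a(1)] w by blast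
qed

text \<open>Ends the descent: modulo the zero ideal, invertibility is invertibility in the ring
  itself.\<close>

lemma (in ring) quotient_zero_Units_iff:
  assumes a: "a \<in> carrier R"
  shows "{\<zero>} +> a \<in> Units (R Quot {\<zero>}) \<longleftrightarrow> a \<in> Units R"
proof -
  interpret Z: ideal "{\<zero>}" R by (rule zeroideal)
  have "x \<ominus> \<one> \<in> {\<zero>} \<longleftrightarrow> x = \<one>" if "x \<in> carrier R" for x
    using that r_right_minus_eq by simp
  then show ?thesis
    using Z.quotient_Units_iff[OF a] a by (auto simp: Units_def)
qed

section \<open>Sums of squares in rings and their quotients\<close>

definition sum_squares :: "('a, 'b) ring_scheme \<Rightarrow> nat \<Rightarrow> (nat \<Rightarrow> 'a) \<Rightarrow> 'a" where
  "sum_squares R n a = (\<Oplus>\<^bsub>R\<^esub>k\<in>{..<n}. a k \<otimes>\<^bsub>R\<^esub> a k)"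

lemma (in ring) sum_squares_closed [simp]:
  "a \<in> {..<n} \<rightarrow> carrier R \<Longrightarrow> sum_squares R n a \<in> carrier R"
  unfolding sum_squares_def by (intro finsum_closed) auto

lemma (in ring) sum_squares_cong:
  "\<lbrakk>b \<in> {..<n} \<rightarrow> carrier R; \<And>k. k < n \<Longrightarrow> a k = b k\<rbrakk> \<Longrightarrow> sum_squares R n a = sum_squares R n b"
  unfolding sum_squares_def by (intro finsum_cong') auto

lemma (in ring_hom_ring) hom_sum_squares:
  assumes a: "a \<in> {..<n} \<rightarrow> carrier R"
  shows "h (sum_squares R n a) = sum_squares S n (\<lambda>k. h (a k))"
proof -
  have "(\<lambda>k. a k \<otimes> a k) \<in> {..<n} \<rightarrow> carrier R"
    using a by auto
  then have "h (sum_squares R n a) = finsum S (h \<circ> (\<lambda>k. a k \<otimes> a k)) {..<n}"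
    unfolding sum_squares_def by (rule hom_finsum)
  also have "\<dots> = sum_squares S n (\<lambda>k. h (a k))"
    unfolding sum_squares_def using a by (intro S.finsum_cong') (auto simp: Pi_iff)
  finally show ?thesis .
qed

lemma (in ideal) rcos_sum_squares_cong:
  assumes a: "a \<in> {..<n} \<rightarrow> carrier R" and b: "b \<in> {..<n} \<rightarrow> carrier R"
    and ab: "\<And>k. k < n \<Longrightarrow> I +> a k = I +> b k"
  shows "I +> sum_squares R n a = I +> sum_squares R n b"
proof -
  interpret q: ring_hom_ring R "R Quot I" "(+>) I" by (rule rcos_ring_hom_ring)
  show ?thesis
    using q.hom_sum_squares[OF a] q.hom_sum_squares[OF b] b ab
      ring.sum_squares_cong[OF q.S.ring_axioms, of "\<lambda>k. I +> b k" n "\<lambda>k. I +> a k"]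
    by (auto simp: Pi_iff)
qed

lemma (in ideal) rcos_eq_iff:
  "\<lbrakk>a \<in> carrier R; b \<in> carrier R\<rbrakk> \<Longrightarrow> I +> a = I +> b \<longleftrightarrow> a \<ominus> b \<in> I"
  using quotient_eq_iff_same_a_r_cos[OF is_ideal] by simp

text \<open>\<open>cstar_quot\<close> and \<open>Quot\<close> have the same ring operations but
  different record extensions; such equations move invertibility questions from the corona algebra
  to the plain quotient ring.\<close>

lemma finsum_cstar_quot: "finsum (cstar_quot A I) f S = finsum (A Quot I) f S"
  by (simp add: finsum_def finprod_def cstar_quot_def FactRing_def)

lemma sum_squares_cstar_quot: "sum_squares (cstar_quot A I) n a = sum_squares (A Quot I) n a"
  by (simp add: sum_squares_def finsum_cstar_quot) (simp add: cstar_quot_def FactRing_def)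

lemma Units_cstar_quot: "Units (cstar_quot A I) = Units (A Quot I)"
  by (simp add: Units_def cstar_quot_def FactRing_def)

section \<open>Property \<open>\<Lambda>\<^sub>n\<close> in terms of the embedded algebra\<close>

lemma (in abelian_group) minus_add_eq_uminus:
  "\<lbrakk>x \<in> carrier G; y \<in> carrier G\<rbrakk> \<Longrightarrow> x \<ominus> (x \<oplus> y) = \<ominus> y"
  by (simp add: minus_eq minus_add a_assoc[symmetric] r_neg)

lemma (in abelian_group) add_uminus_minus:
  "\<lbrakk>x \<in> carrier G; y \<in> carrier G\<rbrakk> \<Longrightarrow> x \<oplus> \<ominus> (x \<ominus> y) = y"
  by (simp add: minus_eq minus_add a_assoc[symmetric] r_neg)

context star_algebra
begin

lemma ideal_canonical_ideal: "ideal (canonical_ideal A) (multiplier_algebra A)"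
  unfolding canonical_ideal_def
  using double_centralizersD(1,2)[THEN bounded_operator_closed]
  by (intro ideal_embedding_image) (auto simp: additive_subgroup_def intro!: M.add.subgroupI)

lemma canonical_ideal_adj:
  "j \<in> canonical_ideal A \<Longrightarrow> adj (multiplier_algebra A) j \<in> canonical_ideal A"
  by (auto simp: canonical_ideal_def multiplier_embedding_adj[symmetric])

lemma multiplier_adj_adj:
  assumes "m \<in> double_centralizers A"
  shows "adj (multiplier_algebra A) (adj (multiplier_algebra A) m) = m"
proof -
  obtain L R where m: "m = (L, R)" by fastforce
  then have "bounded_operator A L" "bounded_operator A R"
    using assms double_centralizersD(1,2) by blast+
  note bo = this[THEN bounded_operator_closed] this[THEN bounded_operator_undefined]
  show ?thesis
    by (auto simp: m bo fun_eq_iff restrict_def)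
qed

text \<open>The adjoint of a coset is its image. The coset of \<open>m\<close> is mapped into
  itself, since the canonical ideal is closed under the adjoint, and the involution turns this
  inclusion into an equality.\<close>

lemma corona_map_self_adjoint:
  assumes m: "m \<in> self_adjoint (multiplier_algebra A)"
  shows "corona_map A m \<in> self_adjoint (corona_algebra A)"
proof -
  let ?M = "multiplier_algebra A" and ?J = "canonical_ideal A"
  interpret J: ideal ?J ?M by (rule ideal_canonical_ideal)
  have mM: "m \<in> carrier ?M" "adj ?M m = m"
    using m by (auto simp: self_adjoint_def)
  have adj: "adj ?M x \<in> corona_map A m" if x: "x \<in> corona_map A m" for x
  proof -
    obtain j where j: "j \<in> ?J" "x = j \<oplus>\<^bsub>?M\<^esub> m"
      using x by (auto simp: corona_map_def a_r_coset_def r_coset_def)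
    then have "adj ?M x = adj ?M j \<oplus>\<^bsub>?M\<^esub> m"
      using J.a_Hcarr[OF j(1)] mM by (simp add: multiplier_adj_add)
    then show ?thesis
      using canonical_ideal_adj[OF j(1)] by (auto simp: corona_map_def a_r_coset_def r_coset_def)
  qed
  have "corona_map A m \<subseteq> double_centralizers A"
    using mM J.a_Hcarr J.a_closed J.a_r_coset_subset_G[OF J.a_subset] unfolding corona_map_def
    by simp
  then have "adj ?M ` corona_map A m = corona_map A m"
    using adj multiplier_adj_adj by (force simp: image_iff)
  moreover have "corona_map A m \<in> a_rcosets\<^bsub>?M\<^esub> ?J"
    unfolding corona_map_def using mM J.a_subset J.a_rcosetsI by simp
  ultimately show ?thesis
    by (simp add: self_adjoint_def corona_algebra_def cstar_quot_def)
qed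

text \<open>Cosets of self-adjoint multipliers are self-adjoint automatically, so only invertibility
  modulo \<open>A\<close> remains of the condition.\<close>

lemma corona_map_Lg_sa_iff:
  assumes a: "a \<in> {..<n} \<rightarrow> self_adjoint (multiplier_algebra A)"
  shows "(\<lambda>j. corona_map A (a j)) \<in> Lg_sa n (corona_algebra A) \<longleftrightarrow>
    corona_map A (sum_squares (multiplier_algebra A) n a)
      \<in> Units (multiplier_algebra A Quot canonical_ideal A)"
proof -
  let ?M = "multiplier_algebra A" and ?J = "canonical_ideal A"
  interpret J: ideal ?J ?M by (rule ideal_canonical_ideal)
  interpret q: ring_hom_ring ?M "?M Quot ?J" "corona_map A"
    unfolding corona_map_def[abs_def] by (rule J.rcos_ring_hom_ring)
  have "a \<in> {..<n} \<rightarrow> carrier ?M"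
    using a by (auto simp: self_adjoint_def)
  then have "corona_map A (sum_squares ?M n a)
      = sum_squares (corona_algebra A) n (\<lambda>j. corona_map A (a j))"
    unfolding corona_algebra_def by (simp add: q.hom_sum_squares sum_squares_cstar_quot)
  then show ?thesis
    using a corona_map_self_adjoint
    by (auto simp: Lg_sa_def sum_squares_def[symmetric] corona_algebra_def Units_cstar_quot Pi_iff
        simp del: split_paired_All)
qed

lemma Lg_sa_multiplier_iff:
  "b \<in> Lg_sa n (multiplier_algebra A) \<longleftrightarrow>
    b \<in> {..<n} \<rightarrow> self_adjoint (multiplier_algebra A) \<and>
    sum_squares (multiplier_algebra A) n b \<in> Units (multiplier_algebra A)"
  by (auto simp: Lg_sa_def sum_squares_def)

lemma multiplier_embedding_self_adjoint:
  "x \<in> self_adjoint A \<Longrightarrow> multiplier_embedding A x \<in> self_adjoint (multiplier_algebra A)"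
  by (auto simp: self_adjoint_def multiplier_embedding_closed multiplier_embedding_adj[symmetric])

text \<open>A tuple with the same cosets as \<open>a\<close> differs from it by elements of
  \<open>A\<close>, so it can be given by these perturbations. Smallness in \<open>A\<close>
  suffices because the embedding does not increase norms.\<close>

lemma property_LambdaI:
  assumes step: "\<And>a \<epsilon>. \<lbrakk>a \<in> {..<n + 1} \<rightarrow> self_adjoint (multiplier_algebra A);
      corona_map A (sum_squares (multiplier_algebra A) (n + 1) a)
        \<in> Units (multiplier_algebra A Quot canonical_ideal A); (0::real) < \<epsilon>\<rbrakk> \<Longrightarrow>
      \<exists>x \<in> {..<n + 1} \<rightarrow> self_adjoint A. (\<forall>k<n + 1. nrm A (x k) < \<epsilon>) \<and>
        sum_squares (multiplier_algebra A) (n + 1)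
          (\<lambda>k. a k \<oplus>\<^bsub>multiplier_algebra A\<^esub> multiplier_embedding A (x k))
        \<in> Units (multiplier_algebra A)"
  shows "property_Lambda n A"
  unfolding property_Lambda_def
proof (intro ballI impI allI)
  let ?M = "multiplier_algebra A" and ?J = "canonical_ideal A"
  interpret J: ideal ?J ?M by (rule ideal_canonical_ideal)
  fix a and \<epsilon> :: real
  assume a: "a \<in> {..<n + 1} \<rightarrow> self_adjoint ?M" and "0 < \<epsilon>"
    and "(\<lambda>j. corona_map A (a j)) \<in> Lg_sa (n + 1) (corona_algebra A)"
  then have "corona_map A (sum_squares ?M (n + 1) a) \<in> Units (?M Quot ?J)"
    using corona_map_Lg_sa_iff by blast
  then obtain x where x: "x \<in> {..<n + 1} \<rightarrow> self_adjoint A" "\<And>k. k < n + 1 \<Longrightarrow> nrm A (x k) < \<epsilon>"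
    "sum_squares ?M (n + 1) (\<lambda>k. a k \<oplus>\<^bsub>?M\<^esub> multiplier_embedding A (x k)) \<in> Units ?M"
    using step[OF a _ \<open>0 < \<epsilon>\<close>] by blast
  define b where "b = (\<lambda>k. a k \<oplus>\<^bsub>?M\<^esub> multiplier_embedding A (x k))"
  have sa: "a k \<in> self_adjoint ?M" "x k \<in> self_adjoint A" if "k < n + 1" for k
    using that a x(1) by auto
  have "b \<in> Lg_sa (n + 1) ?M"
    using x(3) sa
    by (auto simp: Lg_sa_multiplier_iff b_def
        intro!: self_adjoint_multiplier_add multiplier_embedding_self_adjoint)
  moreover have "nrm ?M (a k \<ominus>\<^bsub>?M\<^esub> b k) < \<epsilon>" "corona_map A (a k) = corona_map A (b k)"
    if "k \<le> n" for k
  proof -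
    have ax: "a k \<in> carrier ?M" "x k \<in> carrier A" "nrm A (x k) < \<epsilon>"
      using sa[of k] x(2)[of k] \<open>k \<le> n\<close> by (auto simp: self_adjoint_def)
    then have emb: "multiplier_embedding A (x k) \<in> carrier ?M"
      using multiplier_embedding_closed by simp
    have "a k \<ominus>\<^bsub>?M\<^esub> b k = \<ominus>\<^bsub>?M\<^esub> multiplier_embedding A (x k)"
      unfolding b_def using J.minus_add_eq_uminus[OF ax(1) emb] .
    then have eq: "a k \<ominus>\<^bsub>?M\<^esub> b k = multiplier_embedding A (\<ominus> x k)"
      using ax by (simp add: multiplier_embedding_uminus)
    then show "nrm ?M (a k \<ominus>\<^bsub>?M\<^esub> b k) < \<epsilon>"
      using nrm_multiplier_embedding_le[of "\<ominus> x k"] ax by (simp add: nrm_uminus)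
    have "b k \<in> carrier ?M"
      unfolding b_def using ax(1) emb J.a_closed by simp
    moreover have "a k \<ominus>\<^bsub>?M\<^esub> b k \<in> ?J"
      unfolding eq canonical_ideal_def using ax by simp
    ultimately show "corona_map A (a k) = corona_map A (b k)"
      unfolding corona_map_def using ax J.rcos_eq_iff by blast
  qed
  ultimately show "\<exists>b\<in>Lg_sa (n + 1) ?M. \<forall>j\<le>n.
      nrm ?M (a j \<ominus>\<^bsub>?M\<^esub> b j) < \<epsilon> \<and> corona_map A (a j) = corona_map A (b j)"
    by blast
qed

end

text \<open>The unit \<open>u\<close> may depend on \<open>a\<close> and \<delta>. This pointwise
  form already makes the embedding into the multipliers isometric, and both \<open>I\<close> and
  \<open>A/I\<close> inherit it.\<close>

locale approx_unital_star_algebra = star_algebra +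
  assumes ex_approx_unit: "\<lbrakk>a \<in> carrier A; 0 < \<delta>\<rbrakk> \<Longrightarrow>
    \<exists>u\<in>carrier A. nrm A u \<le> 1 \<and> nrm A (a \<ominus> a \<otimes> u) < \<delta>"
begin

lemma nrm_multiplier_embedding:
  "a \<in> carrier A \<Longrightarrow> nrm (multiplier_algebra A) (multiplier_embedding A a) = nrm A a"
  using nrm_multiplier_embedding_le nrm_le_nrm_multiplier_embedding ex_approx_unit
  by (meson order_antisym)

lemma multiplier_embedding_eq_zero_iff:
  assumes "a \<in> carrier A"
  shows "multiplier_embedding A a = \<zero>\<^bsub>multiplier_algebra A\<^esub> \<longleftrightarrow> a = \<zero>"
  using nrm_multiplier_embedding[of a] nrm_multiplier_embedding[of \<zero>] assms nrm_eq_0_iff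
    multiplier_embedding_zero by auto

lemma inj_on_multiplier_embedding: "inj_on (multiplier_embedding A) (carrier A)"
proof (rule inj_onI)
  let ?M = "multiplier_algebra A"
  interpret RM: ring ?M by (rule ring_multiplier_algebra)
  fix a b assume ab: "a \<in> carrier A" "b \<in> carrier A"
    and eq: "multiplier_embedding A a = multiplier_embedding A b"
  have "multiplier_embedding A (a \<ominus> b) = multiplier_embedding A a
      \<oplus>\<^bsub>?M\<^esub> \<ominus>\<^bsub>?M\<^esub> multiplier_embedding A b"
    using ab by (simp only: M.minus_eq multiplier_embedding_add multiplier_embedding_uminus M.a_inv_closed)
  also have "\<dots> = \<zero>\<^bsub>?M\<^esub>"
    unfolding eq using RM.r_neg ab multiplier_embedding_closed by simp
  finally show "a = b"
    using ab multiplier_embedding_eq_zero_iff[of "a \<ominus> b"] by simp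
qed

text \<open>The converse of \<open>property_LambdaI\<close> rests on approximate units: isometry of
  the embedding turns a bound in \<open>M(A)\<close> into one in \<open>A\<close>, and injectivity
  makes the perturbations self-adjoint.\<close>

lemma property_LambdaE:
  assumes "property_Lambda n A" and a: "a \<in> {..<n + 1} \<rightarrow> self_adjoint (multiplier_algebra A)"
    and "corona_map A (sum_squares (multiplier_algebra A) (n + 1) a)
      \<in> Units (multiplier_algebra A Quot canonical_ideal A)"
    and "0 < \<epsilon>"
  obtains x where "x \<in> {..<n + 1} \<rightarrow> self_adjoint A" "\<And>k. k < n + 1 \<Longrightarrow> nrm A (x k) < \<epsilon>"
    "sum_squares (multiplier_algebra A) (n + 1)
      (\<lambda>k. a k \<oplus>\<^bsub>multiplier_algebra A\<^esub> multiplier_embedding A (x k)) \<in> Units (multiplier_algebra A)"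
proof -
  let ?M = "multiplier_algebra A" and ?J = "canonical_ideal A"
  interpret J: ideal ?J ?M by (rule ideal_canonical_ideal)
  have "(\<lambda>j. corona_map A (a j)) \<in> Lg_sa (n + 1) (corona_algebra A)"
    using corona_map_Lg_sa_iff[OF a] assms(3) by simp
  then obtain b where b: "b \<in> Lg_sa (n + 1) ?M"
    "\<And>j. j \<le> n \<Longrightarrow> nrm ?M (a j \<ominus>\<^bsub>?M\<^esub> b j) < \<epsilon> \<and> corona_map A (a j) = corona_map A (b j)"
    using assms unfolding property_Lambda_def by blast
  have "\<exists>x\<in>self_adjoint A. nrm A x < \<epsilon> \<and> b k = a k \<oplus>\<^bsub>?M\<^esub> multiplier_embedding A x"
    if "k < n + 1" for k
  proof -
    have sa: "a k \<in> carrier ?M" "adj ?M (a k) = a k" "b k \<in> carrier ?M" "adj ?M (b k) = b k"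
      using a b(1) that by (auto simp: Lg_sa_def self_adjoint_def)
    have bk: "nrm ?M (a k \<ominus>\<^bsub>?M\<^esub> b k) < \<epsilon>" "corona_map A (a k) = corona_map A (b k)"
      using b(2)[of k] that by auto
    then have "a k \<ominus>\<^bsub>?M\<^esub> b k \<in> ?J"
      unfolding corona_map_def using sa J.rcos_eq_iff by blast
    then obtain d where d: "d \<in> carrier A" "a k \<ominus>\<^bsub>?M\<^esub> b k = multiplier_embedding A d"
      by (auto simp: canonical_ideal_def)
    have emb: "multiplier_embedding A d \<in> carrier ?M"
      using d(1) multiplier_embedding_closed by simp
    \<comment> \<open>\<open>d\<close> stands for \<open>a k - b k\<close>, so the perturbation that
      leads from \<open>a k\<close> to \<open>b k\<close> is its negative.\<close>
    have eq: "b k = a k \<oplus>\<^bsub>?M\<^esub> multiplier_embedding A (\<ominus> d)"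
      using d J.add_uminus_minus[OF sa(1,3)] by (simp add: multiplier_embedding_uminus)
    have "a k \<oplus>\<^bsub>?M\<^esub> multiplier_embedding A (adj A (\<ominus> d)) = adj ?M (b k)"
      using sa(1,2) d(1) multiplier_embedding_closed
      by (simp add: eq multiplier_adj_add multiplier_embedding_adj)
    also have "\<dots> = a k \<oplus>\<^bsub>?M\<^esub> multiplier_embedding A (\<ominus> d)"
      using sa(4) eq by simp
    finally have "multiplier_embedding A (adj A (\<ominus> d)) = multiplier_embedding A (\<ominus> d)"
      using sa(1) d(1) multiplier_embedding_closed J.add.l_cancel by simp
    then have "\<ominus> d \<in> self_adjoint A"
      using inj_on_multiplier_embedding d(1) by (simp add: inj_on_def self_adjoint_def)
    moreover have "nrm A (\<ominus> d) < \<epsilon>"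
      using bk(1) d nrm_multiplier_embedding by (simp add: nrm_uminus)
    ultimately show ?thesis
      using eq by blast
  qed
  then obtain x where x: "\<And>k. k < n + 1 \<Longrightarrow> x k \<in> self_adjoint A \<and> nrm A (x k) < \<epsilon> \<and>
      b k = a k \<oplus>\<^bsub>?M\<^esub> multiplier_embedding A (x k)"
    by metis
  have "b \<in> {..<n + 1} \<rightarrow> carrier ?M" "sum_squares ?M (n + 1) b \<in> Units ?M"
    using b(1) by (auto simp: Lg_sa_multiplier_iff self_adjoint_def)
  then have "sum_squares ?M (n + 1) (\<lambda>k. a k \<oplus>\<^bsub>?M\<^esub> multiplier_embedding A (x k)) \<in> Units ?M"
    using J.sum_squares_cong[of b "n + 1" "\<lambda>k. a k \<oplus>\<^bsub>?M\<^esub> multiplier_embedding A (x k)"] x by simp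
  then show thesis
    using that[of x] x by auto
qed

end

section \<open>Extending a homomorphism on an ideal to multipliers\<close>

text \<open>Meant for norms that are infima over preimages and need not be attained: estimates are
  available only for \<open>u\<close> strictly above \<open>s\<close>.\<close>

lemma le_mult_if_le_mult_greater:
  fixes K s t :: real
  assumes K: "0 \<le> K" and le: "\<And>u. s < u \<Longrightarrow> t \<le> K * u"
  shows "t \<le> K * s"
proof (rule field_le_epsilon)
  fix \<epsilon> :: real assume "0 < \<epsilon>"
  \<comment> \<open>Dividing by \<open>K + 1\<close> instead of \<open>K\<close> covers
    \<open>K = 0\<close>.\<close>
  then have "t \<le> K * (s + \<epsilon> / (K + 1))"
    using K by (intro le) simp
  also have "\<dots> = K * s + K * (\<epsilon> / (K + 1))"
    by (rule distrib_left)
  also have "K * (\<epsilon> / (K + 1)) \<le> \<epsilon>"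
    using K \<open>0 < \<epsilon>\<close> by (simp add: field_simps)
  finally show "t \<le> K * s + \<epsilon>" by simp
qed

text \<open>
  A homomorphism \<open>\<pi>\<close> from an ideal \<open>Y\<close> of \<open>A\<close> onto \<open>B\<close> extends to multipliers by
  \<open>m \<cdot> \<pi> x = \<pi> (m x)\<close>. The cases used below are \<open>\<pi>\<close> the quotient map \<open>A \<rightarrow> A/I\<close> (with \<open>Y = A\<close>)
  and \<open>\<pi>\<close> the identity of \<open>I\<close> (with \<open>Y = I\<close>).
\<close>

locale multiplier_extension =
  A: star_algebra A + B: approx_unital_star_algebra B
  for A :: "'a cstar" and B :: "'b cstar" (structure) and Y :: "'a set" and \<pi> :: "'a \<Rightarrow> 'b" +
  assumes subgroup_Y: "additive_subgroup Y A"
    and Y_smult: "x \<in> Y \<Longrightarrow> c \<odot>\<^bsub>A\<^esub> x \<in> Y"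
    and Y_adj: "x \<in> Y \<Longrightarrow> adj A x \<in> Y"
    and Y_centralizer: "\<lbrakk>(L, R) \<in> double_centralizers A; x \<in> Y\<rbrakk> \<Longrightarrow> L x \<in> Y \<and> R x \<in> Y"
    and hom_closed: "x \<in> Y \<Longrightarrow> \<pi> x \<in> carrier B"
    and hom_add: "\<lbrakk>x \<in> Y; y \<in> Y\<rbrakk> \<Longrightarrow> \<pi> (x \<oplus>\<^bsub>A\<^esub> y) = \<pi> x \<oplus>\<^bsub>B\<^esub> \<pi> y"
    and hom_mult: "\<lbrakk>x \<in> Y; y \<in> Y\<rbrakk> \<Longrightarrow> \<pi> (x \<otimes>\<^bsub>A\<^esub> y) = \<pi> x \<otimes>\<^bsub>B\<^esub> \<pi> y"
    and hom_smult: "x \<in> Y \<Longrightarrow> \<pi> (c \<odot>\<^bsub>A\<^esub> x) = c \<odot>\<^bsub>B\<^esub> \<pi> x"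
    and hom_adj: "x \<in> Y \<Longrightarrow> \<pi> (adj A x) = adj B (\<pi> x)"
    and hom_lift: "\<lbrakk>b \<in> carrier B; nrm B b < \<epsilon>\<rbrakk> \<Longrightarrow> \<exists>x\<in>Y. \<pi> x = b \<and> nrm A x < \<epsilon>"
    and hom_nrm_le: "x \<in> Y \<Longrightarrow> nrm B (\<pi> x) \<le> nrm A x"
    and kernel_centralizer: "\<lbrakk>(L, R) \<in> double_centralizers A; x \<in> Y; \<pi> x = \<zero>\<^bsub>B\<^esub>\<rbrakk> \<Longrightarrow>
      \<pi> (L x) = \<zero>\<^bsub>B\<^esub> \<and> \<pi> (R x) = \<zero>\<^bsub>B\<^esub>"
begin

sublocale Y: additive_subgroup Y A
  by (rule subgroup_Y)

lemma Y_carrier [simp]: "x \<in> Y \<Longrightarrow> x \<in> carrier A"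
  using Y.a_Hcarr by blast

lemma Y_minus: "\<lbrakk>x \<in> Y; y \<in> Y\<rbrakk> \<Longrightarrow> x \<ominus>\<^bsub>A\<^esub> y \<in> Y"
  using Y_smult[of y "-1"] by (simp add: A.M.minus_eq A.smult_minus_1)

lemma hom_minus: "\<lbrakk>x \<in> Y; y \<in> Y\<rbrakk> \<Longrightarrow> \<pi> (x \<ominus>\<^bsub>A\<^esub> y) = \<pi> x \<ominus>\<^bsub>B\<^esub> \<pi> y"
  using Y_smult[of y "-1"] hom_add[of x "(-1) \<odot>\<^bsub>A\<^esub> y"] hom_smult[of y "-1"] hom_closed[of y]
  by (simp add: A.M.minus_eq A.smult_minus_1 B.M.minus_eq B.smult_minus_1)

lemma hom_zero: "\<pi> \<zero>\<^bsub>A\<^esub> = \<zero>\<^bsub>B\<^esub>"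
  using hom_smult[of "\<zero>\<^bsub>A\<^esub>" 0] hom_closed[of "\<zero>\<^bsub>A\<^esub>"] by simp

text \<open>Multiplication by \<open>x\<close> is itself a double centralizer, so
  \<open>Y_centralizer\<close> applies to it.\<close>

lemma Y_mult:
  assumes "x \<in> Y" "y \<in> Y"
  shows "x \<otimes>\<^bsub>A\<^esub> y \<in> Y"
  using Y_centralizer[of "\<lambda>y\<in>carrier A. x \<otimes>\<^bsub>A\<^esub> y" "\<lambda>y\<in>carrier A. y \<otimes>\<^bsub>A\<^esub> x" y]
    A.multiplier_embedding_closed[of x] assms
  by (simp add: multiplier_embedding_def)

section \<open>Extending a single operator\<close>

definition section_of :: "'b \<Rightarrow> 'a" where
  "section_of y = inv_into Y \<pi> y"

lemma hom_surj: "y \<in> carrier B \<Longrightarrow> y \<in> \<pi> ` Y"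
  using hom_lift[of y "nrm B y + 1"] by auto

lemma section_of_closed: "y \<in> carrier B \<Longrightarrow> section_of y \<in> Y"
  unfolding section_of_def using inv_into_into[OF hom_surj] by simp

lemma hom_section_of [simp]: "y \<in> carrier B \<Longrightarrow> \<pi> (section_of y) = y"
  unfolding section_of_def using f_inv_into_f[OF hom_surj] by simp

text \<open>The rule \<open>m \<cdot> \<pi> x = \<pi> (m x)\<close> with an arbitrary preimage;
  \<open>extend_operator_hom\<close> shows that the choice drops out. Restricting to the carrier
  gives the extensional form that \<open>bounded_operator\<close> demands.\<close>

definition extend_operator :: "('a \<Rightarrow> 'a) \<Rightarrow> 'b \<Rightarrow> 'b" where
  "extend_operator T = (\<lambda>y\<in>carrier B. \<pi> (T (section_of y)))"

definition extend :: "('a \<Rightarrow> 'a) \<times> ('a \<Rightarrow> 'a) \<Rightarrow> ('b \<Rightarrow> 'b) \<times> ('b \<Rightarrow> 'b)" where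
  "extend = map_prod extend_operator extend_operator"

text \<open>Collects what \<open>L\<close> and \<open>R\<close> have in common, so that extension is
  treated once for an operator \<open>T\<close>.\<close>

definition extendable :: "('a \<Rightarrow> 'a) \<Rightarrow> bool" where
  "extendable T \<longleftrightarrow> bounded_operator A T \<and> (\<forall>x\<in>Y. T x \<in> Y \<and> (\<pi> x = \<zero>\<^bsub>B\<^esub> \<longrightarrow> \<pi> (T x) = \<zero>\<^bsub>B\<^esub>))"

lemma extendable_centralizer:
  assumes "(L, R) \<in> double_centralizers A"
  shows "extendable L" "extendable R"
  using A.double_centralizersD(1,2)[OF assms] Y_centralizer[OF assms] kernel_centralizer[OF assms]
  unfolding extendable_def by simp_all

lemma extendableD:
  assumes "extendable T"
  shows "bounded_operator A T" and "x \<in> Y \<Longrightarrow> T x \<in> Y"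
    and "\<lbrakk>x \<in> Y; \<pi> x = \<zero>\<^bsub>B\<^esub>\<rbrakk> \<Longrightarrow> \<pi> (T x) = \<zero>\<^bsub>B\<^esub>"
  using assms by (simp_all add: extendable_def)

text \<open>Two preimages of the same element differ by a kernel element, which \<open>T\<close>
  keeps in the kernel.\<close>

lemma extend_operator_hom:
  assumes T: "extendable T" and x: "x \<in> Y"
  shows "extend_operator T (\<pi> x) = \<pi> (T x)"
proof -
  let ?y = "section_of (\<pi> x)"
  have y: "?y \<in> Y" "\<pi> ?y = \<pi> x"
    using x hom_closed section_of_closed by auto
  then have "\<pi> (?y \<ominus>\<^bsub>A\<^esub> x) = \<zero>\<^bsub>B\<^esub>"
    using x hom_closed by (simp add: hom_minus)
  then have "\<pi> (T (?y \<ominus>\<^bsub>A\<^esub> x)) = \<zero>\<^bsub>B\<^esub>"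
    using extendableD(3)[OF T] x y Y_minus by blast
  moreover have "\<pi> (T (?y \<ominus>\<^bsub>A\<^esub> x)) = \<pi> (T ?y) \<ominus>\<^bsub>B\<^esub> \<pi> (T x)"
    using A.bounded_operator_minus[OF extendableD(1)[OF T]] x y extendableD(2)[OF T]
    by (simp add: hom_minus)
  ultimately show ?thesis
    using x y hom_closed extendableD(2)[OF T] by (simp add: extend_operator_def)
qed

lemma bounded_operator_extend:
  assumes T: "extendable T"
  shows "bounded_operator B (extend_operator T)"
proof -
  note bo = bounded_operatorD(1,3,4)[OF extendableD(1)[OF T]]
  obtain K where K: "0 \<le> K" "\<And>x. x \<in> carrier A \<Longrightarrow> nrm A (T x) \<le> K * nrm A x"
    using A.bounded_operator_bound[OF extendableD(1)[OF T]] by blast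
  note T' = extendableD(2)[OF T] extend_operator_hom[OF T]
  show ?thesis
  proof (rule B.bounded_operatorI[where K = K])
    show "extend_operator T \<in> extensional (carrier B)"
      by (simp add: extend_operator_def)
    fix y assume y: "y \<in> carrier B"
    then obtain x where x: "x \<in> Y" "y = \<pi> x" using hom_surj by blast
    then show "extend_operator T y \<in> carrier B"
      by (simp add: T' hom_closed)
    show "extend_operator T (c \<odot>\<^bsub>B\<^esub> y) = c \<odot>\<^bsub>B\<^esub> extend_operator T y" for c
      using x by (simp add: hom_smult[symmetric] T' Y_smult bo)
    show "extend_operator T (y \<oplus>\<^bsub>B\<^esub> z) = extend_operator T y \<oplus>\<^bsub>B\<^esub> extend_operator T z"
      if "z \<in> carrier B" for z
    proof -
      obtain w where "w \<in> Y" "z = \<pi> w" using \<open>z \<in> carrier B\<close> hom_surj by blast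
      then show ?thesis
        using x by (simp add: hom_add[symmetric] T' Y.a_closed bo)
    qed
    \<comment> \<open>The bound \<open>K\<close> carries over because \<open>y\<close> has preimages
      with norm arbitrarily close to its own.\<close>
    show "nrm B (extend_operator T y) \<le> K * nrm B y"
    proof (rule le_mult_if_le_mult_greater[OF K(1)])
      fix u assume "nrm B y < u"
      then obtain x where x: "x \<in> Y" "\<pi> x = y" "nrm A x < u"
        using hom_lift y by blast
      have "nrm B (extend_operator T y) \<le> nrm A (T x)"
        using hom_nrm_le[OF extendableD(2)[OF T x(1)]] extend_operator_hom[OF T x(1)] x(2) by simp
      also have "\<dots> \<le> K * u"
        using K(2)[OF Y_carrier[OF x(1)]] mult_left_mono[OF less_imp_le[OF x(3)] K(1)] by simp
      finally show "nrm B (extend_operator T y) \<le> K * u" .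
    qed
  qed
qed

lemma extend_operator_eqI:
  assumes "F \<in> extensional (carrier B)" "\<And>x. x \<in> Y \<Longrightarrow> \<pi> (T x) = F (\<pi> x)" "extendable T"
  shows "extend_operator T = F"
proof (rule extensionalityI)
  show "extend_operator T \<in> extensional (carrier B)"
    by (simp add: extend_operator_def)
  show "extend_operator T y = F y" if "y \<in> carrier B" for y
  proof -
    obtain x where x: "x \<in> Y" "y = \<pi> x"
      using hom_surj \<open>y \<in> carrier B\<close> by blast
    then show ?thesis
      using extend_operator_hom[OF assms(3) x(1)] assms(2)[OF x(1)] by simp
  qed
qed (use assms in auto)

section \<open>The homomorphism of multiplier algebras\<close>

lemma extend_closed:
  assumes "m \<in> double_centralizers A"
  shows "extend m \<in> double_centralizers B"
proof -
  obtain L R where m: "m = (L, R)" by fastforce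
  note c = A.double_centralizersD[OF assms[unfolded m]]
  note e = extendable_centralizer[OF assms[unfolded m]]
  note hom = extend_operator_hom[OF e(1)] extend_operator_hom[OF e(2)]
    extendableD(2)[OF e(1)] extendableD(2)[OF e(2)]
  show ?thesis
    unfolding m extend_def map_prod_simp
  proof (rule B.double_centralizersI)
    fix u v assume "u \<in> carrier B" "v \<in> carrier B"
    then obtain x y where xy: "x \<in> Y" "u = \<pi> x" "y \<in> Y" "v = \<pi> y"
      using hom_surj by (meson imageE)
    show "extend_operator L (u \<otimes>\<^bsub>B\<^esub> v) = extend_operator L u \<otimes>\<^bsub>B\<^esub> v"
      "extend_operator R (u \<otimes>\<^bsub>B\<^esub> v) = u \<otimes>\<^bsub>B\<^esub> extend_operator R v"
      "extend_operator R u \<otimes>\<^bsub>B\<^esub> v = u \<otimes>\<^bsub>B\<^esub> extend_operator L v"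
      using xy c(3-5) by (simp_all add: hom hom_mult[symmetric] Y_mult)
  qed (intro bounded_operator_extend e)+
qed

lemma extend_hom: "extend \<in> ring_hom (multiplier_algebra A) (multiplier_algebra B)"
proof (rule ring_hom_memI)
  let ?MA = "multiplier_algebra A" and ?MB = "multiplier_algebra B"
  show "extend m \<in> carrier ?MB" if "m \<in> carrier ?MA" for m
    using that extend_closed by simp
  show "extend \<one>\<^bsub>?MA\<^esub> = \<one>\<^bsub>?MB\<^esub>"
    using A.multiplier_one_closed extendable_centralizer(1)
    by (auto simp: extend_def hom_closed intro!: extend_operator_eqI)
  fix m n assume mn: "m \<in> carrier ?MA" "n \<in> carrier ?MA"
  obtain L1 R1 L2 R2 where LR: "m = (L1, R1)" "n = (L2, R2)" by fastforce
  have dc: "(L1, R1) \<in> double_centralizers A" "(L2, R2) \<in> double_centralizers A"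
    "(compose (carrier A) L1 L2, compose (carrier A) R2 R1) \<in> double_centralizers A"
    "(\<lambda>x\<in>carrier A. L1 x \<oplus>\<^bsub>A\<^esub> L2 x, \<lambda>x\<in>carrier A. R1 x \<oplus>\<^bsub>A\<^esub> R2 x) \<in> double_centralizers A"
    using mn A.multiplier_mult_closed[of m n] A.multiplier_add_closed[of m n] by (simp_all add: LR)
  note e1 = extendable_centralizer[OF dc(1)] and e2 = extendable_centralizer[OF dc(2)]
  note hom = extend_operator_hom[OF e1(1)] extend_operator_hom[OF e1(2)]
    extend_operator_hom[OF e2(1)] extend_operator_hom[OF e2(2)]
    extendableD(2)[OF e1(1)] extendableD(2)[OF e1(2)]
    extendableD(2)[OF e2(1)] extendableD(2)[OF e2(2)]
  show "extend (m \<otimes>\<^bsub>?MA\<^esub> n) = extend m \<otimes>\<^bsub>?MB\<^esub> extend n"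
    using extendable_centralizer[OF dc(3)]
    by (auto simp: extend_def LR compose_def hom hom_closed intro!: extend_operator_eqI)
  show "extend (m \<oplus>\<^bsub>?MA\<^esub> n) = extend m \<oplus>\<^bsub>?MB\<^esub> extend n"
    using extendable_centralizer[OF dc(4)]
    by (auto simp: extend_def LR hom hom_closed hom_add intro!: extend_operator_eqI)
qed

lemma extend_self_adjoint:
  assumes m: "m \<in> self_adjoint (multiplier_algebra A)"
  shows "extend m \<in> self_adjoint (multiplier_algebra B)"
proof -
  obtain L R where LR: "m = (L, R)" by fastforce
  have dc: "(L, R) \<in> double_centralizers A"
    and adj: "(\<lambda>x\<in>carrier A. adj A (R (adj A x))) = L" "(\<lambda>x\<in>carrier A. adj A (L (adj A x))) = R"
    using m by (simp_all add: self_adjoint_def LR)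
  have adjR: "adj A (R (adj A x)) = L x" "adj A (L (adj A x)) = R x" if "x \<in> Y" for x
    using fun_cong[OF adj(1), of x] fun_cong[OF adj(2), of x] that by simp_all
  note e = extendable_centralizer[OF dc]
  note hom = extend_operator_hom[OF e(1)] extend_operator_hom[OF e(2)]
    extendableD(2)[OF e(1)] extendableD(2)[OF e(2)]
  have "extend_operator L = (\<lambda>y\<in>carrier B. adj B (extend_operator R (adj B y)))"
    "extend_operator R = (\<lambda>y\<in>carrier B. adj B (extend_operator L (adj B y)))"
    by (auto simp: hom hom_closed hom_adj[symmetric] Y_adj adjR intro!: extend_operator_eqI e)
  then show ?thesis
    using extend_closed[OF dc] by (simp add: self_adjoint_def LR extend_def)
qed

lemma extend_embedding:
  assumes "x \<in> Y"
  shows "extend (multiplier_embedding A x) = multiplier_embedding B (\<pi> x)"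
proof -
  have dc: "(\<lambda>y\<in>carrier A. x \<otimes>\<^bsub>A\<^esub> y, \<lambda>y\<in>carrier A. y \<otimes>\<^bsub>A\<^esub> x) \<in> double_centralizers A"
    using A.multiplier_embedding_closed[of x] assms by (simp add: multiplier_embedding_def)
  show ?thesis
    using extendable_centralizer[OF dc] assms
    by (auto simp: multiplier_embedding_def extend_def hom_mult hom_closed
        intro!: extend_operator_eqI)
qed

text \<open>A small lift is averaged with its adjoint; isometry of the involution preserves the norm
  bound.\<close>

lemma ex_self_adjoint_lift:
  assumes "y \<in> self_adjoint B" "nrm B y < \<epsilon>"
  shows "\<exists>x\<in>Y \<inter> self_adjoint A. \<pi> x = y \<and> nrm A x < \<epsilon>"
proof -
  have y: "y \<in> carrier B" "adj B y = y"
    using assms(1) by (auto simp: self_adjoint_def)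
  obtain x where x: "x \<in> Y" "\<pi> x = y" "nrm A x < \<epsilon>"
    using hom_lift y(1) assms(2) by blast
  let ?z = "(1/2) \<odot>\<^bsub>A\<^esub> (x \<oplus>\<^bsub>A\<^esub> adj A x)"
  have sum: "x \<oplus>\<^bsub>A\<^esub> adj A x \<in> Y"
    using x Y_adj Y.a_closed by simp
  have "\<pi> ?z = (1/2) \<odot>\<^bsub>B\<^esub> (y \<oplus>\<^bsub>B\<^esub> y)"
    using x sum y Y_adj by (simp add: hom_smult hom_add hom_adj)
  also have "\<dots> = y"
    using y(1) B.smult_add_left[of y "1/2" "1/2"] by (simp add: B.smult_add_right)
  finally have "\<pi> ?z = y" .
  moreover have "adj A ?z = ?z"
    using x by (simp add: A.adj_smult A.adj_add A.M.a_comm)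
  moreover have "nrm A ?z < \<epsilon>"
    using x A.nrm_triangle[of x "adj A x"] by (simp add: A.nrm_smult A.nrm_adj)
  ultimately show ?thesis
    using Y_smult[OF sum] by (intro bexI[of _ ?z]) (auto simp: self_adjoint_def)
qed

text \<open>This is \<open>I\<close> for the quotient map and \<open>{\<zero>}\<close> for the
  identity of \<open>I\<close>.\<close>

definition hom_kernel :: "'a set" where
  "hom_kernel = {x \<in> Y. \<pi> x = \<zero>\<^bsub>B\<^esub>}"

lemma ideal_Y: "ideal (multiplier_embedding A ` Y) (multiplier_algebra A)"
  using subgroup_Y Y_centralizer by (rule A.ideal_embedding_image)

lemma ideal_hom_kernel: "ideal (multiplier_embedding A ` hom_kernel) (multiplier_algebra A)"
proof (rule A.ideal_embedding_image)
  have sub: "hom_kernel \<subseteq> carrier A" and zero: "\<zero>\<^bsub>A\<^esub> \<in> hom_kernel"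
    by (auto simp: hom_kernel_def hom_zero)
  have uminus: "\<ominus>\<^bsub>A\<^esub> x \<in> hom_kernel" if "x \<in> hom_kernel" for x
    using that Y_smult[of x "-1"] hom_smult[of x "-1"]
    by (simp add: hom_kernel_def A.smult_minus_1)
  have add: "x \<oplus>\<^bsub>A\<^esub> y \<in> hom_kernel" if "x \<in> hom_kernel" "y \<in> hom_kernel" for x y
    using that by (simp add: hom_kernel_def hom_add Y.a_closed)
  show "additive_subgroup hom_kernel A"
    unfolding additive_subgroup_def
  proof (rule A.M.add.subgroupI)
    show "hom_kernel \<noteq> {}"
      using zero by blast
  qed (fact sub uminus add)+
  show "L a \<in> hom_kernel \<and> R a \<in> hom_kernel"
    if "(L, R) \<in> double_centralizers A" "a \<in> hom_kernel" for L R a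
    using that(2) Y_centralizer[OF that(1)] kernel_centralizer[OF that(1)]
    by (simp add: hom_kernel_def)
qed

text \<open>Injectivity of the embedding of \<open>B\<close> identifies the part of \<open>Y\<close>
  killed by \<open>extend\<close> with the kernel of \<pi>, which gives
  \<open>quotient_Units_Int_kernel\<close> its concrete meaning here.\<close>

lemma kernel_embedding:
  "{m \<in> multiplier_embedding A ` Y. extend m = \<zero>\<^bsub>multiplier_algebra B\<^esub>}
    = multiplier_embedding A ` hom_kernel"
  using B.multiplier_embedding_eq_zero_iff hom_closed
  by (auto simp: hom_kernel_def extend_embedding simp del: multiplier_algebra_simps)

text \<open>One stage of the descent, from modulus \<open>Y\<close> to modulus
  \<open>hom_kernel\<close>. The perturbation supplied by \<open>B\<close> makes the image
  invertible, its lift to \<open>Y\<close> preserves invertibility modulo \<open>Y\<close>, and the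
  two facts combine by \<open>quotient_Units_Int_kernel\<close>.\<close>

lemma property_Lambda_lift:
  assumes Lambda: "property_Lambda n B"
    and a: "a \<in> {..<n + 1} \<rightarrow> self_adjoint (multiplier_algebra A)"
    and unit: "multiplier_embedding A ` Y +>\<^bsub>multiplier_algebra A\<^esub>
        sum_squares (multiplier_algebra A) (n + 1) a
      \<in> Units (multiplier_algebra A Quot multiplier_embedding A ` Y)"
    and \<epsilon>: "0 < \<epsilon>"
  shows "\<exists>x \<in> {..<n + 1} \<rightarrow> Y \<inter> self_adjoint A. (\<forall>k<n + 1. nrm A (x k) < \<epsilon>) \<and>
    multiplier_embedding A ` hom_kernel +>\<^bsub>multiplier_algebra A\<^esub>
        sum_squares (multiplier_algebra A) (n + 1)
          (\<lambda>k. a k \<oplus>\<^bsub>multiplier_algebra A\<^esub> multiplier_embedding A (x k))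
      \<in> Units (multiplier_algebra A Quot multiplier_embedding A ` hom_kernel)"
proof -
  let ?MA = "multiplier_algebra A" and ?MB = "multiplier_algebra B"
  let ?J = "multiplier_embedding A ` Y"
  interpret J: ideal ?J ?MA by (rule ideal_Y)
  interpret CB: ideal "canonical_ideal B" ?MB by (rule B.ideal_canonical_ideal)
  interpret ext: ring_hom_ring ?MA ?MB extend
    by (rule ring_hom_ringI2[OF A.ring_multiplier_algebra B.ring_multiplier_algebra extend_hom])
  have image: "extend ` ?J = canonical_ideal B"
    unfolding canonical_ideal_def image_image
    using hom_surj hom_closed by (force simp: extend_embedding)
  have aM: "a \<in> {..<n + 1} \<rightarrow> carrier ?MA"
    using a by (auto simp: self_adjoint_def)
  \<comment> \<open>An inverse \<open>z\<close> modulo \<open>Y\<close> is carried forward by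
    \<open>extend\<close>, which maps the embedded \<open>Y\<close> onto the canonical ideal of
    \<open>B\<close>.\<close>
  have "corona_map B (sum_squares ?MB (n + 1) (\<lambda>k. extend (a k)))
      \<in> Units (?MB Quot canonical_ideal B)"
  proof -
    obtain z where z: "z \<in> carrier ?MA" "sum_squares ?MA (n + 1) a \<otimes>\<^bsub>?MA\<^esub> z \<ominus>\<^bsub>?MA\<^esub> \<one>\<^bsub>?MA\<^esub> \<in> ?J"
      "z \<otimes>\<^bsub>?MA\<^esub> sum_squares ?MA (n + 1) a \<ominus>\<^bsub>?MA\<^esub> \<one>\<^bsub>?MA\<^esub> \<in> ?J"
      using J.quotient_Units_iff[of "sum_squares ?MA (n + 1) a"] J.sum_squares_closed[OF aM] unit
      by blast
    have hs: "extend (sum_squares ?MA (n + 1) a) = sum_squares ?MB (n + 1) (\<lambda>k. extend (a k))"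
      using aM by (rule ext.hom_sum_squares)
    have s: "sum_squares ?MA (n + 1) a \<in> carrier ?MA"
      using J.sum_squares_closed[OF aM] .
    have "extend z \<in> carrier ?MB"
      using z(1) by (rule ext.hom_closed)
    moreover have "extend (sum_squares ?MA (n + 1) a) \<otimes>\<^bsub>?MB\<^esub> extend z \<ominus>\<^bsub>?MB\<^esub> \<one>\<^bsub>?MB\<^esub> \<in> canonical_ideal B"
      using imageI[OF z(2), of extend] s z(1) unfolding image
      by (simp add: J.minus_eq CB.minus_eq del: multiplier_algebra_simps)
    moreover have "extend z \<otimes>\<^bsub>?MB\<^esub> extend (sum_squares ?MA (n + 1) a) \<ominus>\<^bsub>?MB\<^esub> \<one>\<^bsub>?MB\<^esub> \<in> canonical_ideal B"
      using imageI[OF z(3), of extend] s z(1) unfolding image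
      by (simp add: J.minus_eq CB.minus_eq del: multiplier_algebra_simps)
    ultimately show ?thesis
      using CB.quotient_Units_iff[OF ext.hom_closed[OF s]] unfolding corona_map_def hs[symmetric]
      by blast
  qed
  moreover have "(\<lambda>k. extend (a k)) \<in> {..<n + 1} \<rightarrow> self_adjoint ?MB"
    using a extend_self_adjoint by blast
  ultimately obtain y where y: "y \<in> {..<n + 1} \<rightarrow> self_adjoint B"
    "\<And>k. k < n + 1 \<Longrightarrow> nrm B (y k) < \<epsilon>"
    "sum_squares ?MB (n + 1) (\<lambda>k. extend (a k) \<oplus>\<^bsub>?MB\<^esub> multiplier_embedding B (y k)) \<in> Units ?MB"
    using B.property_LambdaE[OF Lambda, of "\<lambda>k. extend (a k)" \<epsilon>] \<epsilon> by blast
  have "\<exists>x\<in>Y \<inter> self_adjoint A. \<pi> x = y k \<and> nrm A x < \<epsilon>" if "k < n + 1" for k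
    using ex_self_adjoint_lift y(1,2) that by blast
  then obtain x where x: "\<And>k. k < n + 1 \<Longrightarrow> x k \<in> Y \<inter> self_adjoint A"
    "\<And>k. k < n + 1 \<Longrightarrow> \<pi> (x k) = y k" "\<And>k. k < n + 1 \<Longrightarrow> nrm A (x k) < \<epsilon>"
    by metis
  define b where "b = (\<lambda>k. a k \<oplus>\<^bsub>?MA\<^esub> multiplier_embedding A (x k))"
  have emb: "multiplier_embedding A (x k) \<in> carrier ?MA" if "k < n + 1" for k
    using x(1)[OF that] A.multiplier_embedding_closed by simp
  have ak: "a k \<in> carrier ?MA" if "k < n + 1" for k
    using aM that by auto
  have bM: "b \<in> {..<n + 1} \<rightarrow> carrier ?MA"
    unfolding b_def using ak emb J.a_closed by blast
  \<comment> \<open>Perturbing by elements of \<open>Y\<close> changes no coset modulo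
    \<open>Y\<close>, hence not that of the sum of squares either.\<close>
  have "?J +>\<^bsub>?MA\<^esub> a k = ?J +>\<^bsub>?MA\<^esub> b k" if "k < n + 1" for k
  proof -
    have "a k \<ominus>\<^bsub>?MA\<^esub> b k = multiplier_embedding A (\<ominus>\<^bsub>A\<^esub> x k)"
      unfolding b_def using J.minus_add_eq_uminus[OF ak emb, OF that that] x(1)[OF that]
      by (simp add: A.multiplier_embedding_uminus)
    moreover have "\<ominus>\<^bsub>A\<^esub> x k \<in> Y"
      using x(1)[OF that] Y_smult[of "x k" "-1"] by (simp add: A.smult_minus_1)
    ultimately show ?thesis
      using J.rcos_eq_iff[OF ak[OF that], of "b k"] funcset_mem[OF bM, of k] that by simp
  qed
  then have "?J +>\<^bsub>?MA\<^esub> sum_squares ?MA (n + 1) a = ?J +>\<^bsub>?MA\<^esub> sum_squares ?MA (n + 1) b"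
    using J.rcos_sum_squares_cong[OF aM bM] by simp
  then have unit_b: "?J +>\<^bsub>?MA\<^esub> sum_squares ?MA (n + 1) b \<in> Units (?MA Quot ?J)"
    using unit by simp
  have "extend (b k) = extend (a k) \<oplus>\<^bsub>?MB\<^esub> multiplier_embedding B (y k)" if "k < n + 1" for k
    using x(1,2)[OF that] ext.hom_add[OF ak emb, OF that that]
    by (simp add: b_def extend_embedding del: multiplier_algebra_simps)
  moreover have "(\<lambda>k. extend (a k) \<oplus>\<^bsub>?MB\<^esub> multiplier_embedding B (y k)) \<in> {..<n + 1} \<rightarrow> carrier ?MB"
    using y(1) B.multiplier_embedding_closed ak ext.hom_closed CB.a_closed
    by (auto simp: Pi_iff self_adjoint_def simp del: split_paired_All)
  ultimately have "extend (sum_squares ?MA (n + 1) b) \<in> Units ?MB"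
    using y(3) ext.hom_sum_squares[OF bM]
      CB.sum_squares_cong[of "\<lambda>k. extend (a k) \<oplus>\<^bsub>?MB\<^esub> multiplier_embedding B (y k)" "n + 1" "\<lambda>k. extend (b k)"]
    by simp
  then have "multiplier_embedding A ` hom_kernel +>\<^bsub>?MA\<^esub> sum_squares ?MA (n + 1) b
      \<in> Units (?MA Quot multiplier_embedding A ` hom_kernel)"
    using ext.quotient_Units_Int_kernel[OF J.is_ideal] ideal_hom_kernel CB.is_ideal unit_b
      J.sum_squares_closed[OF bM]
    unfolding kernel_embedding image by blast
  moreover have "x \<in> {..<n + 1} \<rightarrow> Y \<inter> self_adjoint A"
    using x(1) by (intro Pi_I) simp
  ultimately show ?thesis
    using x(3) unfolding b_def by (intro bexI[of _ x] conjI allI impI)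
qed

end

section \<open>Quotients by closed ideals\<close>

locale cstar_algebra_ideal = cstar_algebra +
  fixes I :: "'a set"
  assumes closed_ideal_I: "closed_ideal I A"
begin

sublocale S: star_algebra A
  by (rule star_algebra)

sublocale I: abelian_subgroup I A
  using closed_ideal_subgroup[OF closed_ideal_I] M.abelian_group_axioms
  by (rule abelian_subgroupI3)

abbreviation Q :: "'a set cstar" where
  "Q \<equiv> cstar_quot A I"

lemmas I_smult = closed_ideal_smult[OF closed_ideal_I]
  and I_mult_left = closed_ideal_mult_left[OF closed_ideal_I]
  and I_mult_right = closed_ideal_mult_right[OF closed_ideal_I]
  and I_minus = S.closed_ideal_minus[OF closed_ideal_I]
  and I_adj = closed_ideal_adj[OF closed_ideal_I]

lemma I_carrier: "x \<in> I \<Longrightarrow> x \<in> carrier A"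
  using I.a_Hcarr by blast

section \<open>Operations on cosets\<close>

lemma mem_coset_iff: "x \<in> carrier A \<Longrightarrow> y \<in> I +> x \<longleftrightarrow> y \<in> carrier A \<and> y \<ominus> x \<in> I"
  using I.a_rcos_module[of x y] I.a_elemrcos_carrier[of x y] by (auto simp: M.minus_eq)

lemma coset_eq_iff:
  assumes "x \<in> carrier A" "y \<in> carrier A"
  shows "I +> x = I +> y \<longleftrightarrow> x \<ominus> y \<in> I"
proof
  assume "I +> x = I +> y"
  then show "x \<ominus> y \<in> I"
    using I.a_rcos_self[OF assms(1)] mem_coset_iff[OF assms(2), of x] by simp
next
  assume "x \<ominus> y \<in> I"
  then have "x \<in> I +> y"
    using assms by (simp add: mem_coset_iff)
  then show "I +> x = I +> y"
    using M.a_repr_independence[OF _ assms(2) I.a_subgroup] by simp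
qed

lemma coset_zero: "I +> \<zero> = I"
  using M.a_coset_join2[OF M.zero_closed I.a_subgroup I.zero_closed] .

lemma carrier_quot: "carrier Q = (+>) I ` carrier A"
  by (auto simp: cstar_quot_def A_RCOSETS_defs a_r_coset_def)

lemma zero_quot: "\<zero>\<^bsub>Q\<^esub> = I +> \<zero>"
  by (simp add: coset_zero) (simp add: cstar_quot_def)

lemma add_quot:
  "\<lbrakk>x \<in> carrier A; y \<in> carrier A\<rbrakk> \<Longrightarrow> (I +> x) \<oplus>\<^bsub>Q\<^esub> (I +> y) = I +> (x \<oplus> y)"
  using I.a_rcos_sum by (simp add: cstar_quot_def)

lemma mult_quot:
  assumes "x \<in> carrier A" "y \<in> carrier A"
  shows "(I +> x) \<otimes>\<^bsub>Q\<^esub> (I +> y) = I +> (x \<otimes> y)"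
proof -
  have "I +> (a \<otimes> b) = I +> (x \<otimes> y)" if "a \<in> I +> x" "b \<in> I +> y" for a b
  proof -
    have ab: "a \<in> carrier A" "b \<in> carrier A" "a \<ominus> x \<in> I" "b \<ominus> y \<in> I"
      using that assms by (simp_all add: mem_coset_iff)
    have "a \<otimes> b \<ominus> x \<otimes> y = (a \<otimes> b \<ominus> x \<otimes> b) \<oplus> (x \<otimes> b \<ominus> x \<otimes> y)"
      using ab assms by (intro S.minus_trans) auto
    also have "\<dots> = (a \<ominus> x) \<otimes> b \<oplus> x \<otimes> (b \<ominus> y)"
      using ab assms by (simp add: S.mult_minus_left S.mult_minus_right)
    also have "\<dots> \<in> I"
      using ab assms by (intro I.a_closed I_mult_left I_mult_right)
    finally show ?thesis
      using ab assms by (simp add: coset_eq_iff)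
  qed
  moreover have "x \<in> I +> x" "y \<in> I +> y"
    using assms I.a_rcos_self by auto
  ultimately have "(\<Union>a\<in>I +> x. \<Union>b\<in>I +> y. I +> (a \<otimes> b)) = I +> (x \<otimes> y)"
    by blast
  then show ?thesis
    by (simp add: cstar_quot_def rcoset_mult_def)
qed

lemma smult_quot:
  assumes "x \<in> carrier A"
  shows "c \<odot>\<^bsub>Q\<^esub> (I +> x) = I +> (c \<odot> x)"
proof -
  have "I +> (c \<odot> a) = I +> (c \<odot> x)" if "a \<in> I +> x" for a
    using that assms I_smult[of "a \<ominus> x" c]
    by (simp add: mem_coset_iff coset_eq_iff S.smult_minus)
  moreover have "x \<in> I +> x"
    using assms I.a_rcos_self by auto
  ultimately have "(\<Union>a\<in>I +> x. I +> (c \<odot> a)) = I +> (c \<odot> x)"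
    by blast
  then show ?thesis
    by (simp add: cstar_quot_def)
qed

lemma adj_quot:
  assumes "x \<in> carrier A"
  shows "adj Q (I +> x) = I +> adj A x"
proof -
  have adj: "adj A a \<in> I +> adj A y" if "a \<in> I +> y" "y \<in> carrier A" for a y
    using that I_adj[of "a \<ominus> y"] by (simp add: mem_coset_iff S.adj_minus)
  have "adj A ` (I +> x) = I +> adj A x"
  proof
    show "adj A ` (I +> x) \<subseteq> I +> adj A x"
      using adj assms by blast
    show "I +> adj A x \<subseteq> adj A ` (I +> x)"
    proof
      fix a assume a: "a \<in> I +> adj A x"
      then have "a = adj A (adj A a)" "adj A a \<in> I +> x"
        using adj[OF a] assms by (simp_all add: mem_coset_iff)
      then show "a \<in> adj A ` (I +> x)" by blast
    qed
  qed
  then show ?thesis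
    by (simp add: cstar_quot_def)
qed

section \<open>The quotient norm\<close>

lemma nrm_quot: "nrm Q (I +> x) = (INF a\<in>I +> x. nrm A a)"
  by (simp add: cstar_quot_def)

lemma bdd_below_nrm_coset: "x \<in> carrier A \<Longrightarrow> bdd_below (nrm A ` (I +> x))"
  by (rule bdd_belowI2[where m = 0]) (simp add: mem_coset_iff)

lemma nrm_quot_le: "x \<in> carrier A \<Longrightarrow> nrm Q (I +> x) \<le> nrm A x"
  unfolding nrm_quot using bdd_below_nrm_coset I.a_rcos_self by (intro cINF_lower)

lemma coset_nonempty: "x \<in> carrier A \<Longrightarrow> I +> x \<noteq> {}"
  using I.a_rcos_self by blast

lemma nrm_quot_nonneg: "x \<in> carrier A \<Longrightarrow> 0 \<le> nrm Q (I +> x)"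
  unfolding nrm_quot using coset_nonempty by (intro cINF_greatest) (auto simp: mem_coset_iff)

lemma nrm_quot_less:
  assumes x: "x \<in> carrier A" and less: "nrm Q (I +> x) < \<epsilon>"
  obtains a where "a \<in> carrier A" "I +> a = I +> x" "nrm A a < \<epsilon>"
proof -
  obtain a where "a \<in> I +> x" "nrm A a < \<epsilon>"
    using coset_nonempty[OF x] less cINF_less_iff[OF _ bdd_below_nrm_coset[OF x]] unfolding nrm_quot by blast
  then show thesis
    using that[of a] x by (simp add: mem_coset_iff coset_eq_iff)
qed

lemma nrm_quot_le_if_le:
  assumes "x \<in> carrier A" "0 \<le> K"
    and "\<And>a. \<lbrakk>a \<in> carrier A; I +> a = I +> x\<rbrakk> \<Longrightarrow> t \<le> K * nrm A a"
  shows "t \<le> K * nrm Q (I +> x)"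
proof (rule le_mult_if_le_mult_greater[OF assms(2)])
  fix u assume "nrm Q (I +> x) < u"
  then obtain a where a: "a \<in> carrier A" "I +> a = I +> x" "nrm A a < u"
    using nrm_quot_less[OF assms(1)] by blast
  show "t \<le> K * u"
    using assms(3)[OF a(1,2)] mult_left_mono[OF less_imp_le[OF a(3)] assms(2)] by linarith
qed

lemma nrm_quot_triangle:
  assumes "x \<in> carrier A" "y \<in> carrier A"
  shows "nrm Q (I +> (x \<oplus> y)) \<le> nrm Q (I +> x) + nrm Q (I +> y)"
proof (rule field_le_epsilon)
  fix \<epsilon> :: real assume "0 < \<epsilon>"
  then have less: "nrm Q (I +> x) < nrm Q (I +> x) + \<epsilon> / 2" "nrm Q (I +> y) < nrm Q (I +> y) + \<epsilon> / 2"
    by simp_all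
  obtain a where a: "a \<in> carrier A" "I +> a = I +> x" "nrm A a < nrm Q (I +> x) + \<epsilon> / 2"
    using nrm_quot_less[OF assms(1) less(1)] by blast
  obtain b where b: "b \<in> carrier A" "I +> b = I +> y" "nrm A b < nrm Q (I +> y) + \<epsilon> / 2"
    using nrm_quot_less[OF assms(2) less(2)] by blast
  have "I +> (x \<oplus> y) = I +> (a \<oplus> b)"
    using assms a b by (simp add: add_quot[symmetric])
  then have "nrm Q (I +> (x \<oplus> y)) \<le> nrm A (a \<oplus> b)"
    using a b nrm_quot_le by simp
  also have "\<dots> \<le> nrm A a + nrm A b"
    using a b by (intro S.nrm_triangle)
  finally show "nrm Q (I +> (x \<oplus> y)) \<le> nrm Q (I +> x) + nrm Q (I +> y) + \<epsilon>"
    using a b by simp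
qed

lemma nrm_quot_mult:
  assumes "x \<in> carrier A" "y \<in> carrier A"
  shows "nrm Q (I +> (x \<otimes> y)) \<le> nrm Q (I +> x) * nrm Q (I +> y)"
proof (rule nrm_quot_le_if_le[OF assms(2) nrm_quot_nonneg[OF assms(1)]])
  fix b assume b: "b \<in> carrier A" "I +> b = I +> y"
  \<comment> \<open>The infimum over representatives is taken in one factor at a time, here with
    \<open>b\<close> fixed.\<close>
  have "nrm Q (I +> (x \<otimes> y)) \<le> nrm A b * nrm Q (I +> x)"
  proof (rule nrm_quot_le_if_le[OF assms(1) S.nrm_nonneg[OF b(1)]])
    fix a assume a: "a \<in> carrier A" "I +> a = I +> x"
    have "I +> (x \<otimes> y) = I +> (a \<otimes> b)"
      using assms a b by (simp add: mult_quot[symmetric])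
    then show "nrm Q (I +> (x \<otimes> y)) \<le> nrm A b * nrm A a"
      using a b nrm_quot_le[of "a \<otimes> b"] S.nrm_mult[of a b] by (simp add: mult.commute)
  qed
  then show "nrm Q (I +> (x \<otimes> y)) \<le> nrm Q (I +> x) * nrm A b"
    by (simp add: mult.commute)
qed

lemma nrm_quot_smult_le:
  assumes "x \<in> carrier A"
  shows "nrm Q (I +> (c \<odot> x)) \<le> cmod c * nrm Q (I +> x)"
proof (rule nrm_quot_le_if_le[OF assms norm_ge_zero])
  fix a assume a: "a \<in> carrier A" "I +> a = I +> x"
  have "I +> (c \<odot> x) = I +> (c \<odot> a)"
    using assms a by (simp add: smult_quot[symmetric])
  then show "nrm Q (I +> (c \<odot> x)) \<le> cmod c * nrm A a"
    using a nrm_quot_le[of "c \<odot> a"] by (simp add: S.nrm_smult)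
qed

text \<open>For nonzero \<open>c\<close>, the inequality for \<open>1 / c\<close> supplies the
  reverse estimate.\<close>

lemma nrm_quot_smult:
  assumes x: "x \<in> carrier A"
  shows "nrm Q (I +> (c \<odot> x)) = cmod c * nrm Q (I +> x)"
proof (cases "c = 0")
  case True
  then show ?thesis
    using x nrm_quot_smult_le[OF x, of 0] nrm_quot_nonneg[of \<zero>] by simp
next
  case False
  have "nrm Q (I +> x) \<le> cmod (1 / c) * nrm Q (I +> (c \<odot> x))"
    using nrm_quot_smult_le[of "c \<odot> x" "1 / c"] x False by (simp add: S.smult_smult)
  then have "cmod c * nrm Q (I +> x) \<le> nrm Q (I +> (c \<odot> x))"
    using False by (simp add: norm_divide field_simps)
  then show ?thesis
    using nrm_quot_smult_le[OF x, of c] by simp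
qed

lemma nrm_quot_adj_le:
  assumes "x \<in> carrier A"
  shows "nrm Q (I +> adj A x) \<le> nrm Q (I +> x)"
proof -
  have "nrm Q (I +> adj A x) \<le> 1 * nrm Q (I +> x)"
  proof (rule nrm_quot_le_if_le[OF assms])
    fix a assume a: "a \<in> carrier A" "I +> a = I +> x"
    have "I +> adj A x = I +> adj A a"
      using assms a by (simp add: adj_quot[symmetric])
    then show "nrm Q (I +> adj A x) \<le> 1 * nrm A a"
      using a nrm_quot_le[of "adj A a"] by (simp add: S.nrm_adj)
  qed simp
  then show ?thesis by simp
qed

text \<open>Closedness of \<open>I\<close> makes the quotient norm definite: if \<open>a\<close> is
  a small representative, then \<open>x \<ominus> a\<close> is an element of \<open>I\<close> close
  to \<open>x\<close>.\<close>

lemma nrm_quot_eq_0_iff: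
  assumes x: "x \<in> carrier A"
  shows "nrm Q (I +> x) = 0 \<longleftrightarrow> I +> x = I +> \<zero>"
proof
  assume 0: "nrm Q (I +> x) = 0"
  have "x \<in> I"
  proof (rule S.closed_ideal_approx[OF closed_ideal_I x])
    fix \<delta> :: real assume "0 < \<delta>"
    then obtain a where a: "a \<in> carrier A" "I +> a = I +> x" "nrm A a < \<delta>"
      using nrm_quot_less[OF x, of \<delta>] 0 by auto
    have "x \<ominus> a \<in> I"
      using a coset_eq_iff[OF x a(1)] by simp
    moreover have "x \<ominus> (x \<ominus> a) = a"
      using x a by (intro S.minus_minus_cancel)
    ultimately show "\<exists>i\<in>I. nrm A (x \<ominus> i) < \<delta>"
      using a(3) by metis
  qed
  then show "I +> x = I +> \<zero>"
    using M.a_coset_join2[OF x I.a_subgroup] by (simp add: coset_zero)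
next
  assume "I +> x = I +> \<zero>"
  then show "nrm Q (I +> x) = 0"
    using nrm_quot_le[of \<zero>] nrm_quot_nonneg[of \<zero>] by simp
qed

lemma star_algebra_quot: "star_algebra Q"
proof -
  note quot = zero_quot add_quot mult_quot smult_quot adj_quot
  have "abelian_group Q"
  proof (rule abelian_groupI, unfold carrier_quot)
    show "\<exists>S'\<in>(+>) I ` carrier A. S' \<oplus>\<^bsub>Q\<^esub> S = \<zero>\<^bsub>Q\<^esub>" if "S \<in> (+>) I ` carrier A" for S
    proof -
      obtain x where x: "x \<in> carrier A" "S = I +> x" using \<open>S \<in> _\<close> by blast
      then have "(I +> \<ominus> x) \<oplus>\<^bsub>Q\<^esub> S = \<zero>\<^bsub>Q\<^esub>"
        by (simp add: quot M.l_neg)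
      then show ?thesis using x by blast
    qed
  qed (auto simp: quot M.a_ac)
  then have "module ring_of_type_algebra Q"
    by (intro moduleI R.is_cring)
      (auto simp: carrier_quot quot S.smult_add_left S.smult_add_right S.smult_smult)
  moreover have "nrm Q (I +> adj A x) = nrm Q (I +> x)" if "x \<in> carrier A" for x
    using nrm_quot_adj_le[of x] nrm_quot_adj_le[of "adj A x"] that by simp
  ultimately show ?thesis
    by (intro star_algebra.intro star_algebra_axioms.intro)
      (auto simp: carrier_quot quot S.mult_assoc S.mult_l_distr S.mult_r_distr S.smult_mult_left
        S.smult_mult_right S.adj_add S.adj_smult S.adj_mult nrm_quot_nonneg nrm_quot_eq_0_iff
        nrm_quot_triangle nrm_quot_smult nrm_quot_mult)
qed

lemma minus_quot:
  assumes "x \<in> carrier A" "y \<in> carrier A"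
  shows "(I +> x) \<ominus>\<^bsub>Q\<^esub> (I +> y) = I +> (x \<ominus> y)"
proof -
  interpret Q: star_algebra Q by (rule star_algebra_quot)
  show ?thesis
    using assms Q.smult_minus_1[of "I +> y"] add_quot[of x "\<ominus> y"]
    by (simp add: Q.M.minus_eq M.minus_eq carrier_quot smult_quot S.smult_minus_1)
qed

text \<open>The quotient map does not increase norms, so it carries approximate units of
  \<open>A\<close> to approximate units of \<open>A/I\<close>.\<close>

lemma approx_unital_star_algebra_quot: "approx_unital_star_algebra Q"
proof (intro approx_unital_star_algebra.intro approx_unital_star_algebra_axioms.intro
    star_algebra_quot)
  fix S and \<delta> :: real assume "S \<in> carrier Q" "0 < \<delta>"
  then obtain x where x: "x \<in> carrier A" "S = I +> x"
    by (auto simp: carrier_quot)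
  obtain u where u: "u \<in> carrier A" "nrm A u \<le> 1" "nrm A (x \<ominus> x \<otimes> u) < \<delta>"
    using ex_approximate_unit_right[OF closed_ideal_carrier x(1) \<open>0 < \<delta>\<close>] by blast
  have "nrm Q (I +> u) \<le> 1"
    using nrm_quot_le[of u] u by simp
  moreover have "nrm Q (S \<ominus>\<^bsub>Q\<^esub> S \<otimes>\<^bsub>Q\<^esub> (I +> u)) < \<delta>"
    using x u nrm_quot_le[of "x \<ominus> x \<otimes> u"] by (simp add: mult_quot minus_quot)
  ultimately show "\<exists>u\<in>carrier Q. nrm Q u \<le> 1 \<and> nrm Q (S \<ominus>\<^bsub>Q\<^esub> S \<otimes>\<^bsub>Q\<^esub> u) < \<delta>"
    using u(1) by (auto simp: carrier_quot)
qed

end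

section \<open>Closed ideals and the two extensions\<close>

lemma self_adjoint_iff: "x \<in> self_adjoint D \<longleftrightarrow> x \<in> carrier D \<and> adj D x = x"
  by (simp add: self_adjoint_def)

context cstar_algebra_ideal
begin

abbreviation A\<^sub>I :: "'a cstar" where
  "A\<^sub>I \<equiv> A\<lparr>carrier := I\<rparr>"

lemma star_algebra_ideal: "star_algebra A\<^sub>I"
proof -
  have "abelian_group A\<^sub>I"
  proof (rule abelian_groupI)
    show "\<exists>y\<in>carrier A\<^sub>I. y \<oplus>\<^bsub>A\<^sub>I\<^esub> x = \<zero>\<^bsub>A\<^sub>I\<^esub>" if "x \<in> carrier A\<^sub>I" for x
      using that I_smult[of x "-1"] I_carrier[of x]
      by (intro bexI[of _ "\<ominus> x"]) (simp_all add: M.l_neg S.smult_minus_1)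
  qed (use I_carrier in \<open>auto simp: M.a_ac I.a_closed I.zero_closed\<close>)
  then have "module ring_of_type_algebra A\<^sub>I"
    using I_carrier I_smult
    by (intro moduleI R.is_cring)
      (auto simp: S.smult_add_left S.smult_add_right S.smult_smult)
  then show ?thesis
    using I_carrier I_mult_left I_adj
    by (intro star_algebra.intro star_algebra_axioms.intro)
      (auto simp: S.mult_assoc S.mult_l_distr S.mult_r_distr S.smult_mult_left
        S.smult_mult_right S.adj_add S.adj_smult S.adj_mult S.nrm_eq_0_iff
        S.nrm_triangle S.nrm_smult S.nrm_mult S.nrm_adj)
qed

text \<open>The additive inverse is defined relative to the carrier, so it has to be checked that
  shrinking the carrier does not alter it; the scalar \<open>-1\<close>, common to both, decides
  this.\<close>

lemma minus_ideal:
  assumes "x \<in> I" "y \<in> I"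
  shows "x \<ominus>\<^bsub>A\<^sub>I\<^esub> y = x \<ominus> y"
proof -
  interpret AI: star_algebra A\<^sub>I by (rule star_algebra_ideal)
  show ?thesis
    using assms AI.smult_minus_1[of y] I_carrier
    by (simp add: AI.M.minus_eq M.minus_eq S.smult_minus_1)
qed

lemma approx_unital_star_algebra_ideal: "approx_unital_star_algebra A\<^sub>I"
proof (intro approx_unital_star_algebra.intro approx_unital_star_algebra_axioms.intro
    star_algebra_ideal)
  fix x and \<delta> :: real assume "x \<in> carrier A\<^sub>I" "0 < \<delta>"
  then have x: "x \<in> I" by simp
  obtain u where u: "u \<in> I" "nrm A u \<le> 1" "nrm A (x \<ominus> x \<otimes> u) < \<delta>"
    using ex_approximate_unit_right[OF closed_ideal_I x \<open>0 < \<delta>\<close>] by blast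
  have "x \<otimes> u \<in> I"
    using x u I_carrier I_mult_left by blast
  then show "\<exists>u\<in>carrier A\<^sub>I. nrm A\<^sub>I u \<le> 1 \<and> nrm A\<^sub>I (x \<ominus>\<^bsub>A\<^sub>I\<^esub> x \<otimes>\<^bsub>A\<^sub>I\<^esub> u) < \<delta>"
    using x u by (auto simp: minus_ideal)
qed

text \<open>Approximating \<open>x\<close> by \<open>xe\<close> with \<open>e \<in> I\<close> gives \<open>L x \<approx> L x e \<in> I\<close>; similarly for \<open>R\<close>.\<close>

lemma centralizer_ideal:
  assumes LR: "(L, R) \<in> double_centralizers A" and x: "x \<in> I"
  shows "L x \<in> I" "R x \<in> I"
proof -
  have T: "T x \<in> I"
    if bo: "bounded_operator A T"
      and approx: "\<And>\<delta>. 0 < \<delta> \<Longrightarrow> \<exists>y\<in>I. T y \<in> I \<and> nrm A (x \<ominus> y) < \<delta>" for T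
  proof (rule S.closed_ideal_approx[OF closed_ideal_I])
    obtain K where K: "0 \<le> K" "\<And>x. x \<in> carrier A \<Longrightarrow> nrm A (T x) \<le> K * nrm A x"
      using S.bounded_operator_bound[OF bo] by blast
    have xA: "x \<in> carrier A" using x by (rule I_carrier)
    then show "T x \<in> carrier A" by (rule bounded_operator_closed[OF bo])
    fix \<delta> :: real assume "0 < \<delta>"
    \<comment> \<open>The factor \<open>K + 1\<close> absorbs the bound of \<open>T\<close> and also
      covers \<open>K = 0\<close>.\<close>
    then obtain y where y: "y \<in> I" "T y \<in> I" "nrm A (x \<ominus> y) < \<delta> / (K + 1)"
      using approx[of "\<delta> / (K + 1)"] K(1) by auto
    have yA: "y \<in> carrier A" using y(1) by (rule I_carrier)
    have "nrm A (T x \<ominus> T y) = nrm A (T (x \<ominus> y))"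
      using S.bounded_operator_minus[OF bo xA yA] by simp
    also have "\<dots> \<le> K * (\<delta> / (K + 1))"
      using K(2)[of "x \<ominus> y"] xA yA mult_left_mono[OF less_imp_le[OF y(3)] K(1)] by simp
    also have "\<dots> < \<delta>"
      using K(1) \<open>0 < \<delta>\<close> by (simp add: field_simps)
    finally show "\<exists>i\<in>I. nrm A (T x \<ominus> i) < \<delta>"
      using y(2) by blast
  qed
  note c = S.double_centralizersD[OF LR]
  have "\<exists>y\<in>I. L y \<in> I \<and> nrm A (x \<ominus> y) < \<delta>" if \<delta>: "0 < \<delta>" for \<delta>
  proof -
    obtain e where e: "e \<in> I" "nrm A (x \<ominus> x \<otimes> e) < \<delta>"
      using ex_approximate_unit_right[OF closed_ideal_I x \<delta>] by blast
    then show ?thesis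
      using c(3)[of x e] I_carrier[OF x] I_carrier[OF e(1)] I_mult_left
        bounded_operator_closed[OF c(1)]
      by (intro bexI[of _ "x \<otimes> e"]) auto
  qed
  then show "L x \<in> I" by (rule T[OF c(1)])
  have "\<exists>y\<in>I. R y \<in> I \<and> nrm A (x \<ominus> y) < \<delta>" if \<delta>: "0 < \<delta>" for \<delta>
  proof -
    obtain e where e: "e \<in> I" "nrm A (x \<ominus> e \<otimes> x) < \<delta>"
      using ex_approximate_unit_left[OF closed_ideal_I x \<delta>] by blast
    then show ?thesis
      using c(4)[of e x] I_carrier[OF x] I_carrier[OF e(1)] I_mult_right
        bounded_operator_closed[OF c(2)]
      by (intro bexI[of _ "e \<otimes> x"]) auto
  qed
  then show "R x \<in> I" by (rule T[OF c(2)])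
qed

lemma centralizer_zero:
  assumes LR: "(L, R) \<in> double_centralizers A"
  shows "L \<zero> = \<zero>" "R \<zero> = \<zero>"
  using bounded_operator_smult[OF S.double_centralizersD(1)[OF LR], of \<zero> 0]
    bounded_operator_smult[OF S.double_centralizersD(2)[OF LR], of \<zero> 0]
    bounded_operator_closed[OF S.double_centralizersD(1)[OF LR], of \<zero>]
    bounded_operator_closed[OF S.double_centralizersD(2)[OF LR], of \<zero>]
  by simp_all

text \<open>The substance is \<open>Y_centralizer\<close>, the invariance of \<open>I\<close> under
  multipliers of \<open>A\<close>; the kernel is trivial.\<close>

lemma multiplier_extension_ideal: "multiplier_extension A A\<^sub>I I (\<lambda>x. x)"
proof (intro multiplier_extension.intro multiplier_extension_axioms.intro star_algebra
    approx_unital_star_algebra_ideal closed_ideal_subgroup[OF closed_ideal_I])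
  show "L x \<in> I \<and> R x \<in> I" if "(L, R) \<in> double_centralizers A" "x \<in> I" for L R x
    using centralizer_ideal[OF that] by simp
  show "L x = \<zero>\<^bsub>A\<^sub>I\<^esub> \<and> R x = \<zero>\<^bsub>A\<^sub>I\<^esub>"
    if "(L, R) \<in> double_centralizers A" "x = \<zero>\<^bsub>A\<^sub>I\<^esub>" for L R x
    using centralizer_zero[OF that(1)] that(2) by simp
qed (auto intro: I_smult I_adj)

lemma coset_eq_zero_iff: "x \<in> carrier A \<Longrightarrow> I +> x = \<zero>\<^bsub>Q\<^esub> \<longleftrightarrow> x \<in> I"
  using coset_eq_iff[of x \<zero>] S.add_minus_cancel[of x \<zero>] by (simp add: zero_quot)

text \<open>Here invariance of \<open>I\<close> serves as \<open>kernel_centralizer\<close>, and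
  \<open>hom_lift\<close> holds because the quotient norm is an infimum over
  representatives.\<close>

lemma multiplier_extension_quot: "multiplier_extension A Q (carrier A) ((+>) I)"
proof (intro multiplier_extension.intro multiplier_extension_axioms.intro star_algebra
    approx_unital_star_algebra_quot closed_ideal_subgroup[OF closed_ideal_carrier])
  show "\<exists>x\<in>carrier A. I +> x = S \<and> nrm A x < \<epsilon>" if S: "S \<in> carrier Q" "nrm Q S < \<epsilon>" for S \<epsilon>
  proof -
    obtain x where x: "x \<in> carrier A" "S = I +> x"
      using S(1) by (auto simp: carrier_quot)
    then obtain a where "a \<in> carrier A" "I +> a = I +> x" "nrm A a < \<epsilon>"
      using nrm_quot_less S(2) by blast
    then show ?thesis
      using x(2) by auto
  qed
  show "L x \<in> carrier A \<and> R x \<in> carrier A"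
    if "(L, R) \<in> double_centralizers A" "x \<in> carrier A" for L R x
    using that(2) S.double_centralizersD(1,2)[OF that(1)] by (simp add: bounded_operator_closed)
  then show "I +> L x = \<zero>\<^bsub>Q\<^esub> \<and> I +> R x = \<zero>\<^bsub>Q\<^esub>"
    if "(L, R) \<in> double_centralizers A" "x \<in> carrier A" "I +> x = \<zero>\<^bsub>Q\<^esub>" for L R x
    using that centralizer_ideal[OF that(1), of x] by (simp add: coset_eq_zero_iff)
qed (auto simp: carrier_quot add_quot mult_quot smult_quot adj_quot nrm_quot_le)

text \<open>Two stages lower the modulus from \<open>A\<close> to \<open>I\<close> and from
  \<open>I\<close> to zero. Each spends \<epsilon>/2, and the sum of the two perturbations is again
  self-adjoint in \<open>A\<close>.\<close>

lemma property_Lambda_extension: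
  assumes ideal: "property_Lambda n A\<^sub>I" and quot: "property_Lambda n Q"
  shows "property_Lambda n A"
proof (rule S.property_LambdaI)
  let ?M = "multiplier_algebra A" and ?e = "multiplier_embedding A"
  interpret EQ: multiplier_extension A Q "carrier A" "(+>) I"
    by (rule multiplier_extension_quot)
  interpret EI: multiplier_extension A A\<^sub>I I "\<lambda>x. x"
    by (rule multiplier_extension_ideal)
  interpret RM: ring ?M by (rule S.ring_multiplier_algebra)
  have "x \<in> EQ.hom_kernel \<longleftrightarrow> x \<in> I" for x
    using coset_eq_zero_iff[of x] I_carrier[of x] unfolding EQ.hom_kernel_def mem_Collect_eq by metis
  then have kernel_EQ: "EQ.hom_kernel = I"
    by (rule Set.set_eqI)
  have "x \<in> EI.hom_kernel \<longleftrightarrow> x \<in> {\<zero>}" for x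
    unfolding EI.hom_kernel_def mem_Collect_eq singleton_iff using I.zero_closed by (cases "x = \<zero>") simp_all
  then have kernel_EI: "EI.hom_kernel = {\<zero>}"
    by (rule Set.set_eqI)
  fix a and \<epsilon> :: real
  assume a: "a \<in> {..<n + 1} \<rightarrow> self_adjoint ?M" and \<epsilon>: "0 < \<epsilon>"
    and unit_a: "corona_map A (sum_squares ?M (n + 1) a) \<in> Units (?M Quot canonical_ideal A)"
  have unit_a': "?e ` carrier A +>\<^bsub>?M\<^esub> sum_squares ?M (n + 1) a \<in> Units (?M Quot ?e ` carrier A)"
    using unit_a unfolding corona_map_def canonical_ideal_def .
  obtain x where x: "x \<in> {..<n + 1} \<rightarrow> carrier A \<inter> self_adjoint A"
    "\<And>k. k < n + 1 \<Longrightarrow> nrm A (x k) < \<epsilon> / 2"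
    "?e ` I +>\<^bsub>?M\<^esub> sum_squares ?M (n + 1) (\<lambda>k. a k \<oplus>\<^bsub>?M\<^esub> ?e (x k)) \<in> Units (?M Quot ?e ` I)"
    using EQ.property_Lambda_lift[OF quot a unit_a' half_gt_zero[OF \<epsilon>], unfolded kernel_EQ]
    by blast
  define b where "b = (\<lambda>k. a k \<oplus>\<^bsub>?M\<^esub> ?e (x k))"
  have xk: "x k \<in> self_adjoint A" if "k < n + 1" for k
    using funcset_mem[OF x(1), of k] that by blast
  have ak: "a k \<in> self_adjoint ?M" if "k < n + 1" for k
    using funcset_mem[OF a, of k] that by blast
  have b: "b \<in> {..<n + 1} \<rightarrow> self_adjoint ?M"
  proof
    fix k assume "k \<in> {..<n + 1}"
    then have k: "k < n + 1" by simp
    show "b k \<in> self_adjoint ?M"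
      unfolding b_def
      by (rule S.self_adjoint_multiplier_add[OF ak[OF k]
            S.multiplier_embedding_self_adjoint[OF xk[OF k]]])
  qed
  obtain y where y: "y \<in> {..<n + 1} \<rightarrow> I \<inter> self_adjoint A"
    "\<And>k. k < n + 1 \<Longrightarrow> nrm A (y k) < \<epsilon> / 2"
    "?e ` {\<zero>} +>\<^bsub>?M\<^esub> sum_squares ?M (n + 1) (\<lambda>k. b k \<oplus>\<^bsub>?M\<^esub> ?e (y k)) \<in> Units (?M Quot ?e ` {\<zero>})"
    \<comment> \<open>The second stage starts from the perturbed tuple \<open>b\<close>, whose sum
      of squares is invertible modulo \<open>I\<close> by the first.\<close>
    using EI.property_Lambda_lift[OF ideal b x(3)[folded b_def] half_gt_zero[OF \<epsilon>],
        unfolded kernel_EI]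
    by blast
  have yk: "y k \<in> self_adjoint A" if "k < n + 1" for k
    using funcset_mem[OF y(1), of k] that by blast
  have c: "(\<lambda>k. b k \<oplus>\<^bsub>?M\<^esub> ?e (y k)) \<in> {..<n + 1} \<rightarrow> carrier ?M"
  proof
    fix k assume k: "k \<in> {..<n + 1}"
    then have "k < n + 1" by simp
    then have "b k \<oplus>\<^bsub>?M\<^esub> ?e (y k) \<in> self_adjoint ?M"
      by (rule S.self_adjoint_multiplier_add[OF funcset_mem[OF b k]
            S.multiplier_embedding_self_adjoint[OF yk]])
    then show "b k \<oplus>\<^bsub>?M\<^esub> ?e (y k) \<in> carrier ?M"
      by (simp add: self_adjoint_def)
  qed
  have unit: "sum_squares ?M (n + 1) (\<lambda>k. b k \<oplus>\<^bsub>?M\<^esub> ?e (y k)) \<in> Units ?M"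
    using y(3) RM.quotient_zero_Units_iff[OF RM.sum_squares_closed[OF c]]
    by (simp only: image_insert image_empty S.multiplier_embedding_zero)
  have "a k \<oplus>\<^bsub>?M\<^esub> ?e (x k \<oplus> y k) = b k \<oplus>\<^bsub>?M\<^esub> ?e (y k)" if "k < n + 1" for k
  proof -
    have ka: "a k \<in> carrier ?M" and kx: "x k \<in> carrier A" and ky: "y k \<in> carrier A"
      using ak[OF that] xk[OF that] yk[OF that] by (simp_all only: self_adjoint_iff)
    have "?e (x k) \<in> carrier ?M" "?e (y k) \<in> carrier ?M"
      using S.multiplier_embedding_closed[OF kx] S.multiplier_embedding_closed[OF ky] by simp_all
    then show ?thesis
      unfolding b_def S.multiplier_embedding_add[OF kx ky] by (rule RM.a_assoc[OF ka, symmetric])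
  qed
  then have "sum_squares ?M (n + 1) (\<lambda>k. a k \<oplus>\<^bsub>?M\<^esub> ?e (x k \<oplus> y k))
      = sum_squares ?M (n + 1) (\<lambda>k. b k \<oplus>\<^bsub>?M\<^esub> ?e (y k))"
    by (rule RM.sum_squares_cong[OF c])
  then have "sum_squares ?M (n + 1) (\<lambda>k. a k \<oplus>\<^bsub>?M\<^esub> ?e (x k \<oplus> y k)) \<in> Units ?M"
    using unit by (rule ssubst)
  moreover have "x k \<oplus> y k \<in> self_adjoint A \<and> nrm A (x k \<oplus> y k) < \<epsilon>" if k: "k < n + 1" for k
  proof -
    have xA: "x k \<in> carrier A" "adj A (x k) = x k" and yA: "y k \<in> carrier A" "adj A (y k) = y k"
      using xk[OF k] yk[OF k] by (simp_all only: self_adjoint_iff)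
    have "nrm A (x k) < \<epsilon> / 2" "nrm A (y k) < \<epsilon> / 2"
      using x(2) y(2) k by blast+
    then show ?thesis
      using S.nrm_triangle[OF xA(1) yA(1)] M.a_closed[OF xA(1) yA(1)] S.adj_add[OF xA(1) yA(1)]
      unfolding self_adjoint_iff xA(2) yA(2) by linarith
  qed
  ultimately show "\<exists>z\<in>{..<n + 1} \<rightarrow> self_adjoint A. (\<forall>k<n + 1. nrm A (z k) < \<epsilon>) \<and>
      sum_squares ?M (n + 1) (\<lambda>k. a k \<oplus>\<^bsub>?M\<^esub> ?e (z k)) \<in> Units ?M"
    by (intro bexI[of _ "\<lambda>k. x k \<oplus> y k"] conjI allI impI Pi_I) blast+
qed

end

text \<open>The condition that all \<open>m \<ge> n\<close> have the property persists as
  \<open>n\<close> grows, so comparison with the least such \<open>n\<close> is the condition at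
  \<open>n\<close> itself.\<close>

lemma xrr_le_enat_iff: "xrr A \<le> enat n \<longleftrightarrow> (\<forall>m\<ge>n. property_Lambda m A)"
proof
  assume le: "xrr A \<le> enat n"
  then have ex: "\<exists>n. \<forall>m\<ge>n. property_Lambda m A"
    by (auto simp: xrr_def split: if_splits)
  then have "(LEAST n. \<forall>m\<ge>n. property_Lambda m A) \<le> n"
    using le by (simp add: xrr_def)
  then show "\<forall>m\<ge>n. property_Lambda m A"
    using LeastI_ex[OF ex] by (meson order_trans)
next
  assume "\<forall>m\<ge>n. property_Lambda m A"
  then show "xrr A \<le> enat n"
    by (auto simp: xrr_def intro: Least_le)
qed

theorem proposition4p2:
  fixes A :: "'a cstar" and I :: "'a set"
  assumes "cstar_algebra A"
    and "closed_ideal I A"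
  shows "xrr A \<le> max (xrr (A\<lparr>carrier := I\<rparr>)) (xrr (cstar_quot A I))"
proof -
  interpret cstar_algebra_ideal A I
    using assms by (intro cstar_algebra_ideal.intro cstar_algebra_ideal_axioms.intro)
  show ?thesis
  proof (cases "max (xrr (A\<lparr>carrier := I\<rparr>)) (xrr (cstar_quot A I))")
    \<comment> \<open>If the maximum is infinite the bound is trivial; if it is \<open>n\<close>,
      both algebras have the property for every \<open>m \<ge> n\<close>, and the extension lemma
      applies to each such \<open>m\<close>.\<close>
    case (enat n)
    then have "xrr (A\<lparr>carrier := I\<rparr>) \<le> enat n" "xrr (cstar_quot A I) \<le> enat n"
      by (metis max.cobounded1, metis max.cobounded2)
    then have "xrr A \<le> enat n"
      using property_Lambda_extension by (simp add: xrr_le_enat_iff)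
    then show ?thesis
      using enat by simp
  qed simp
qed

end
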